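(* Let $(\mathcal O,\mathcal C,\mathbf 2_{\mathcal C},\iota_{\mathcal C})$ be a total SFC-category and let $I_{\mathcal T}:\mathcal C_{\mathcal T}\to\mathcal C$ be the inclusion of the full subcategory of fiber-terminal objects. Then: (1) $(\mathcal OI_{\mathcal T},\mathcal C_{\mathcal T},\mathbf 2_{\mathcal C},\iota_{\mathcal C})$ is an SFC-category; (2) $(I_{\mathcal T},\mathrm{id}_{\mathcal OI_{\mathcal T}},\mathrm{id}_{\mathbf 2_{\mathcal C}}):(\mathcal OI_{\mathcal T},\mathcal C_{\mathcal T},\mathbf 2_{\mathcal C},\iota_{\mathcal C})\to(\mathcal O,\mathcal C,\mathbf 2_{\mathcal C},\iota_{\mathcal C})$ is an SFC-functor; (3) the induced right adjunction morphism $\mathsf{Dual}(I_{\mathcal T},\mathrm{id}_{\mathcal OI_{\mathcal T}},\mathrm{id}_{\mathbf 2_{\mathcal C}})$, from the adjunction between $\mathcal C_{\mathcal T}$ and $\mathbf{Top}_{\mathcal T}^{\mathrm{op}}$ to the adjunction $\mathsf{pt}_{\mathcal C}\dashv\Omega_{\mathcal C}$ between $\mathcal C$ and $\mathbf{Top}^{\mathrm{op}}$, whose functors are $I_{\mathcal T}$ and the inclusion $\mathbf{Top}_{\mathcal T}^{\mathrm{op}}\hookrightarrow\mathbf{Top}^{\mathrm{op}}$, is a strong adjunction morphism.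
   Context: $\mathbf{Frm}$ is the category of frames and frame homomorphisms, $\mathbf 2=\{0<1\}$, $\mathbf{Top}$ ($\mathbf{Top}_0$) the category of ($T_0$) topological spaces, $\mathbb S$ the Sierpinski space ($\{0,1\}$ with opens $\emptyset,\{1\},\{0,1\}$); $|\cdot|$ denotes underlying sets and functions. Lifts. Let $U:\mathcal A\to\mathcal B$ be faithful. A morphism $f:U(A)\to U(A')$ lifts if $f=U(p)$ for a (unique) $p$, its lift. A cartesian lift w.r.t. $U$ of a family $\{f_i:X\to U(C)\}$ is a pair $(\overline X,\theta)$, $\overline X\in\mathcal A$, $\theta:U(\overline X)\to X$ an isomorphism, such that for every $D$ a morphism $h:U(D)\to U(\overline X)$ lifts iff every $f_i\theta h$ lifts. A PFC-category is a quadruple $(\mathcal O_{\mathcal C},\mathcal C,\mathbf 2_{\mathcal C},\iota_{\mathcal C})$ with $\mathcal O_{\mathcal C}:\mathcal C\to\mathbf{Frm}$ faithful, $\mathbf 2_{\mathcal C}\in\mathcal C$, $\iota_{\mathcal C}:\mathcal O_{\mathcal C}(\mathbf 2_{\mathcal C})\cong\mathbf 2$. $\mathbf{Top}_{\mathcal C}\subseteq\mathbf{Top}$ is the full subcategory of spaces $X$ for which $\{|\iota_{\mathcal C}^{-1}|\circ\chi_x:\mathbf{Top}(X,\mathbb S)\to|\mathcal O_{\mathcal C}(\mathbf 2_{\mathcal C})|\mid x\in X\}$, $\chi_x(g)=g(x)$, has a cartesian lift $(\Omega_{\mathcal C}X,\theta_{\mathcal C,X})$ w.r.t. $|\mathcal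 O_{\mathcal C}(-)|$; $\overline{\chi_x}$ is the lift of $|\iota_{\mathcal C}^{-1}|\circ\chi_x\circ\theta_{\mathcal C,X}$. $\mathsf{pt}_{\mathcal C}(C)$ is $\mathcal C(C,\mathbf 2_{\mathcal C})$ with opens $\{f\mid\iota_{\mathcal C}(\mathcal O_{\mathcal C}f(a))=1\}$, $a\in\mathcal O_{\mathcal C}(C)$. It is an SFC-category if $\mathbb S$ and all $\mathsf{pt}_{\mathcal C}(C)$ are in $\mathbf{Top}_{\mathcal C}$. Then there is an adjunction $\mathsf{pt}_{\mathcal C}\dashv\Omega_{\mathcal C}$ between $\mathcal C$ and $\mathbf{Top}_{\mathcal C}^{\mathrm{op}}$, with $\mathsf{pt}_{\mathcal C}$ acting by precomposition, $\Omega_{\mathcal C}f$ the lift of $\theta_{\mathcal C,X}^{-1}(-\circ f)\theta_{\mathcal C,Y}$, and units $\sigma^{\mathcal C}_X:x\mapsto\overline{\chi_x}$, $\theta\circ|\mathcal O_{\mathcal C}\eta^{\mathcal C}_C|(a)=(f\mapsto\iota_{\mathcal C}(\mathcal O_{\mathcal C}f(a)))$. $\mathsf{Fix}(\mathbf{Top}_{\mathcal C})$ is the full subcategory of $X\in\mathbf{Top}_{\mathcal C}$ with $\sigma^{\mathcal C}_X$ a homeomorphism. An SFC-functor $(H,\alpha,i)$ from $(\mathcal O_{\mathcal C},\mathcal C,\mathbf 2_{\mathcal C},\iota_{\mathcal C})$ to $(\mathcal O_{\mathcal D},\mathcal D,\mathbf 2_{\mathcal D},\iota_{\mathcal D})$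 is a functor $H:\mathcal C\to\mathcal D$, a natural isomorphism $\alpha:\mathcal O_{\mathcal D}H\to\mathcal O_{\mathcal C}$ and an isomorphism $i:H\mathbf 2_{\mathcal C}\to\mathbf 2_{\mathcal D}$ with $\iota_{\mathcal D}\circ\mathcal O_{\mathcal D}(i)=\iota_{\mathcal C}\circ\alpha_{\mathbf 2_{\mathcal C}}$, such that for each $X\in\mathbf{Top}_{\mathcal C}$, $(H\Omega_{\mathcal C}X,\theta_{\mathcal C,X}\circ|\alpha_{\Omega_{\mathcal C}X}|)$ is a cartesian lift w.r.t. $|\mathcal O_{\mathcal D}(-)|$ of $\{|\alpha_{\mathbf 2_{\mathcal C}}^{-1}|\circ|\iota_{\mathcal C}^{-1}|\circ\chi_x\mid x\in X\}$. Then $\mathbf{Top}_{\mathcal C}\subseteq\mathbf{Top}_{\mathcal D}$, and $\mathsf{Dual}(H,\alpha,i)$ is the right adjunction morphism given by $H$, this inclusion, $\zeta^H_X:H\Omega_{\mathcal C}X\to\Omega_{\mathcal D}X$ with underlying function $\theta_{\mathcal D,X}^{-1}\theta_{\mathcal C,X}|\alpha_{\Omega_{\mathcal C}X}|$, and $\xi^H_C:\mathsf{pt}_{\mathcal C}C\to\mathsf{pt}_{\mathcal D}HC$, $f\mapsto i\circ H(f)$. For adjunctions $F\dashv G$ (unit $\eta$) and $P\dashv Q$ (counit $\delta$), a right adjunction morphism consists of functors $U,V$ and a mate-pair $\zeta:UG\to QV$, $\xi:PU\to VF$ (i.e. $\xi=\delta_{VF}\circ P\zeta_F\circ PU\eta$)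 with $\zeta$ invertible; it is strong if $\xi$ is also invertible. The fiber $\mathcal O^{-1}(L)$ is the preorder of pairs $(C,\theta^C)$, $\theta^C:\mathcal O(C)\cong L$, with $(C,\theta^C)\le(D,\theta^D)$ iff there is $p:C\to D$ with $\theta^D\circ\mathcal O(p)=\theta^C$. $C$ is fiber-initial (fiber-terminal) if $(C,\mathrm{id})$ is a bottom (top) element of $\mathcal O^{-1}(\mathcal O(C))$. If $\mathbf 2_{\mathcal C}\in\mathcal C_{\mathcal T}$, $\mathbf{Top}_{\mathcal T}$ denotes $\mathbf{Top}_{\mathcal D}$ for the PFC-category $\mathcal D=(\mathcal OI_{\mathcal T},\mathcal C_{\mathcal T},\mathbf 2_{\mathcal C},\iota_{\mathcal C})$. An SFC-category is total if: (T1) $\mathbf{Top}_{\mathcal C}=\mathbf{Top}$ and $\mathsf{Fix}(\mathbf{Top}_{\mathcal C})=\mathbf{Top}_0$; (T2) $\mathbf 2_{\mathcal C}$ and $\Omega_{\mathcal C}\mathbb S$ are both fiber-initial and fiber-terminal; (T3) $\mathcal O$ has a left adjoint with invertible unit; (T4) $\mathsf{pt}_{\mathcal C}(C)\in\mathbf{Top}_{\mathcal T}$ for all $C\in\mathcal C_{\mathcal T}$. *)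

theory Defs
  imports "HOL-Analysis.Analysis" "HOL-Algebra.Complete_Lattice"
begin

section \<open>Universes\<close>

text \<open>
  A type \<open>'u\<close> of this class plays the role of a universe of sets. The points of spaces, the
  elements of frames and the arrows of the categories under study all live in \<open>'u\<close>, and a
  subset of \<open>'u\<close> is small (a set rather than a proper class) if it has fewer elements than \<open>'u\<close>.
  A Grothendieck universe \<open>V\<^sub>\<kappa>\<close> (\<open>\<kappa>\<close> inaccessible) is an instance: it has cardinality \<open>\<kappa>\<close>, and
  its subsets of cardinality less than \<open>\<kappa>\<close> are precisely its elements. Only closure under power
  sets is required, since no other closure property is needed to form function spaces. The two
  constants \<open>0\<close> and \<open>1\<close> are the elements of the frame \<open>2\<close> and the points of the Sierpinski space.
\<close>

class universe = zero_neq_one +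
  assumes infinite_universe: "infinite (UNIV :: 'a set)"
    and Pow_lesspoll_universe:
      "(A :: 'a set) \<prec> (UNIV :: 'a set) \<Longrightarrow> Pow A \<prec> (UNIV :: 'a set)"

definition small :: "'u set \<Rightarrow> bool"
  where "small A \<longleftrightarrow> A \<prec> (UNIV :: 'u set)"


section \<open>Categories, functors, adjunctions\<close>

text \<open>
  Hom-sets for different pairs of objects need not be disjoint; hence composition and the arrow
  part of a functor take the objects involved as arguments. \<open>Cmp K A B C g f\<close> is the composite
  of \<open>f : A \<rightarrow> B\<close> and \<open>g : B \<rightarrow> C\<close>.
\<close>

record ('o, 'm) cat =
  Obj :: "'o set"
  Hom :: "'o \<Rightarrow> 'o \<Rightarrow> 'm set"
  Cmp :: "'o \<Rightarrow> 'o \<Rightarrow> 'o \<Rightarrow> 'm \<Rightarrow> 'm \<Rightarrow> 'm"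
  Idt :: "'o \<Rightarrow> 'm"

definition category :: "('o, 'm) cat \<Rightarrow> bool" where
  "category K \<longleftrightarrow>
    (\<forall>A\<in>Obj K. Idt K A \<in> Hom K A A) \<and>
    (\<forall>A\<in>Obj K. \<forall>B\<in>Obj K. \<forall>C\<in>Obj K. \<forall>f\<in>Hom K A B. \<forall>g\<in>Hom K B C. Cmp K A B C g f \<in> Hom K A C) \<and>
    (\<forall>A\<in>Obj K. \<forall>B\<in>Obj K. \<forall>f\<in>Hom K A B.
       Cmp K A A B f (Idt K A) = f \<and> Cmp K A B B (Idt K B) f = f) \<and>
    (\<forall>A\<in>Obj K. \<forall>B\<in>Obj K. \<forall>C\<in>Obj K. \<forall>D\<in>Obj K. \<forall>f\<in>Hom K A B. \<forall>g\<in>Hom K B C. \<forall>h\<in>Hom K C D.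
       Cmp K A B D (Cmp K B C D h g) f = Cmp K A C D h (Cmp K A B C g f))"

definition iso_arr :: "('o, 'm) cat \<Rightarrow> 'o \<Rightarrow> 'o \<Rightarrow> 'm \<Rightarrow> bool" where
  "iso_arr K A B f \<longleftrightarrow>
    f \<in> Hom K A B \<and> (\<exists>g\<in>Hom K B A. Cmp K A B A g f = Idt K A \<and> Cmp K B A B f g = Idt K B)"

definition op_cat :: "('o, 'm) cat \<Rightarrow> ('o, 'm) cat" where
  "op_cat K = \<lparr>Obj = Obj K, Hom = (\<lambda>A B. Hom K B A),
               Cmp = (\<lambda>A B C g f. Cmp K C B A f g), Idt = Idt K\<rparr>"

definition full_sub :: "('o, 'm) cat \<Rightarrow> 'o set \<Rightarrow> ('o, 'm) cat" where
  "full_sub K S = K\<lparr>Obj := Obj K \<inter> S\<rparr>"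

record ('o, 'm, 'p, 'n) fctr =
  fobj :: "'o \<Rightarrow> 'p"
  farr :: "'o \<Rightarrow> 'o \<Rightarrow> 'm \<Rightarrow> 'n"

definition is_functor :: "('o, 'm) cat \<Rightarrow> ('p, 'n) cat \<Rightarrow> ('o, 'm, 'p, 'n) fctr \<Rightarrow> bool" where
  "is_functor K L F \<longleftrightarrow> category K \<and> category L \<and>
    (\<forall>A\<in>Obj K. fobj F A \<in> Obj L) \<and>
    (\<forall>A\<in>Obj K. \<forall>B\<in>Obj K. \<forall>f\<in>Hom K A B. farr F A B f \<in> Hom L (fobj F A) (fobj F B)) \<and>
    (\<forall>A\<in>Obj K. farr F A A (Idt K A) = Idt L (fobj F A)) \<and>
    (\<forall>A\<in>Obj K. \<forall>B\<in>Obj K. \<forall>C\<in>Obj K. \<forall>f\<in>Hom K A B. \<forall>g\<in>Hom K B C.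
       farr F A C (Cmp K A B C g f) =
         Cmp L (fobj F A) (fobj F B) (fobj F C) (farr F B C g) (farr F A B f))"

definition faithful :: "('o, 'm) cat \<Rightarrow> ('o, 'm, 'p, 'n) fctr \<Rightarrow> bool" where
  "faithful K F \<longleftrightarrow> (\<forall>A\<in>Obj K. \<forall>B\<in>Obj K. inj_on (farr F A B) (Hom K A B))"

text \<open>\<open>incl\<close> serves as the identity functor and as the inclusion of any full subcategory.\<close>

definition incl :: "('o, 'm, 'o, 'm) fctr" where
  "incl = \<lparr>fobj = (\<lambda>A. A), farr = (\<lambda>A B f. f)\<rparr>"

definition fcomp ::
  "('p, 'n, 'q, 'k) fctr \<Rightarrow> ('o, 'm, 'p, 'n) fctr \<Rightarrow> ('o, 'm, 'q, 'k) fctr" where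
  "fcomp G F = \<lparr>fobj = (\<lambda>A. fobj G (fobj F A)),
                farr = (\<lambda>A B f. farr G (fobj F A) (fobj F B) (farr F A B f))\<rparr>"

definition nat_trans ::
  "('o, 'm) cat \<Rightarrow> ('p, 'n) cat \<Rightarrow> ('o, 'm, 'p, 'n) fctr \<Rightarrow> ('o, 'm, 'p, 'n) fctr \<Rightarrow> ('o \<Rightarrow> 'n) \<Rightarrow> bool"
where
  "nat_trans K L F G t \<longleftrightarrow> is_functor K L F \<and> is_functor K L G \<and>
    (\<forall>A\<in>Obj K. t A \<in> Hom L (fobj F A) (fobj G A)) \<and>
    (\<forall>A\<in>Obj K. \<forall>B\<in>Obj K. \<forall>f\<in>Hom K A B.
       Cmp L (fobj F A) (fobj F B) (fobj G B) (t B) (farr F A B f) =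
       Cmp L (fobj F A) (fobj G A) (fobj G B) (farr G A B f) (t A))"

definition nat_iso ::
  "('o, 'm) cat \<Rightarrow> ('p, 'n) cat \<Rightarrow> ('o, 'm, 'p, 'n) fctr \<Rightarrow> ('o, 'm, 'p, 'n) fctr \<Rightarrow> ('o \<Rightarrow> 'n) \<Rightarrow> bool"
where
  "nat_iso K L F G t \<longleftrightarrow>
    nat_trans K L F G t \<and> (\<forall>A\<in>Obj K. iso_arr L (fobj F A) (fobj G A) (t A))"

record ('o, 'm, 'p, 'n) adj =
  ladj :: "('o, 'm, 'p, 'n) fctr"
  radj :: "('p, 'n, 'o, 'm) fctr"
  unit :: "'o \<Rightarrow> 'm"
  counit :: "'p \<Rightarrow> 'n"

definition adjunction :: "('o, 'm) cat \<Rightarrow> ('p, 'n) cat \<Rightarrow> ('o, 'm, 'p, 'n) adj \<Rightarrow> bool" where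
  "adjunction K L J \<longleftrightarrow>
    is_functor K L (ladj J) \<and> is_functor L K (radj J) \<and>
    nat_trans K K incl (fcomp (radj J) (ladj J)) (unit J) \<and>
    nat_trans L L (fcomp (ladj J) (radj J)) incl (counit J) \<and>
    (\<forall>A\<in>Obj K. let FA = fobj (ladj J) A; GFA = fobj (radj J) FA; FGFA = fobj (ladj J) GFA in
       Cmp L FA FGFA FA (counit J FA) (farr (ladj J) A GFA (unit J A)) = Idt L FA) \<and>
    (\<forall>B\<in>Obj L. let GB = fobj (radj J) B; FGB = fobj (ladj J) GB; GFGB = fobj (radj J) FGB in
       Cmp K GB GFGB GB (farr (radj J) FGB B (counit J B)) (unit J GB) = Idt K GB)"

text \<open>
  For adjunctions \<open>F \<stileturn> G\<close> between \<open>A\<close> and \<open>B\<close>, and \<open>P \<stileturn> Q\<close> between \<open>A'\<close> and \<open>B'\<close>, the data of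
  a right adjunction morphism are functors \<open>U : A \<rightarrow> A'\<close>, \<open>V : B \<rightarrow> B'\<close> and
  \<open>\<zeta> : U G \<rightarrow> Q V\<close>, \<open>\<xi> : P U \<rightarrow> V F\<close>.
\<close>

record ('o, 'm, 'p, 'n, 'o1, 'm1, 'p1, 'n1) adj_mor =
  lfun :: "('o, 'm, 'o1, 'm1) fctr"
  rfun :: "('p, 'n, 'p1, 'n1) fctr"
  zeta :: "'p \<Rightarrow> 'm1"
  xi :: "'o \<Rightarrow> 'n1"

definition right_adj_morphism ::
  "('o, 'm) cat \<Rightarrow> ('p, 'n) cat \<Rightarrow> ('o, 'm, 'p, 'n) adj \<Rightarrow>
   ('o1, 'm1) cat \<Rightarrow> ('p1, 'n1) cat \<Rightarrow> ('o1, 'm1, 'p1, 'n1) adj \<Rightarrow>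
   ('o, 'm, 'p, 'n, 'o1, 'm1, 'p1, 'n1) adj_mor \<Rightarrow> bool" where
  "right_adj_morphism A B J A' B' J' M \<longleftrightarrow>
    adjunction A B J \<and> adjunction A' B' J' \<and>
    is_functor A A' (lfun M) \<and> is_functor B B' (rfun M) \<and>
    nat_iso B A' (fcomp (lfun M) (radj J)) (fcomp (radj J') (rfun M)) (zeta M) \<and>
    nat_trans A B' (fcomp (ladj J') (lfun M)) (fcomp (rfun M) (ladj J)) (xi M) \<and>
    (\<forall>a\<in>Obj A.
       let Fa = fobj (ladj J) a; GFa = fobj (radj J) Fa; VFa = fobj (rfun M) Fa;
           QVFa = fobj (radj J') VFa; PQVFa = fobj (ladj J') QVFa;
           Ua = fobj (lfun M) a; PUa = fobj (ladj J') Ua;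
           UGFa = fobj (lfun M) GFa; PUGFa = fobj (ladj J') UGFa
       in xi M a =
            Cmp B' PUa PQVFa VFa (counit J' VFa)
              (Cmp B' PUa PUGFa PQVFa
                 (farr (ladj J') UGFa QVFa (zeta M Fa))
                 (farr (ladj J') Ua UGFa (farr (lfun M) a GFa (unit J a)))))"

definition strong_right_adj_morphism ::
  "('o, 'm) cat \<Rightarrow> ('p, 'n) cat \<Rightarrow> ('o, 'm, 'p, 'n) adj \<Rightarrow>
   ('o1, 'm1) cat \<Rightarrow> ('p1, 'n1) cat \<Rightarrow> ('o1, 'm1, 'p1, 'n1) adj \<Rightarrow>
   ('o, 'm, 'p, 'n, 'o1, 'm1, 'p1, 'n1) adj_mor \<Rightarrow> bool" where
  "strong_right_adj_morphism A B J A' B' J' M \<longleftrightarrow>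
    right_adj_morphism A B J A' B' J' M \<and>
    nat_iso A B' (fcomp (ladj J') (lfun M)) (fcomp (rfun M) (ladj J)) (xi M)"


section \<open>Frames and spaces\<close>

definition is_frame :: "'a gorder \<Rightarrow> bool" where
  "is_frame L \<longleftrightarrow> Complete_Lattice.complete_lattice L \<and>
    (\<forall>a\<in>carrier L. \<forall>B\<subseteq>carrier L.
       a \<sqinter>\<^bsub>L\<^esub> (\<Squnion>\<^bsub>L\<^esub> B) = \<Squnion>\<^bsub>L\<^esub> ((\<lambda>b. a \<sqinter>\<^bsub>L\<^esub> b) ` B))"

definition frame_hom :: "'a gorder \<Rightarrow> 'b gorder \<Rightarrow> ('a \<Rightarrow> 'b) \<Rightarrow> bool" where
  "frame_hom L M f \<longleftrightarrow> f \<in> carrier L \<rightarrow> carrier M \<and>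
    sup_pres L M f \<and> meet_pres L M f \<and> f \<top>\<^bsub>L\<^esub> = \<top>\<^bsub>M\<^esub>"

definition Frm :: "('u::universe gorder, 'u \<Rightarrow> 'u) cat" where
  "Frm = \<lparr>Obj = {L. is_frame L \<and> small (carrier L)},
          Hom = (\<lambda>L M. {f. frame_hom L M f \<and> f \<in> extensional (carrier L)}),
          Cmp = (\<lambda>L M N g f. compose (carrier L) g f),
          Idt = (\<lambda>L. restrict (\<lambda>a. a) (carrier L))\<rparr>"

definition frame2 :: "'u::universe gorder" where
  "frame2 = \<lparr>carrier = {0, 1}, eq = (=), le = (\<lambda>x y. x = 0 \<or> y = 1)\<rparr>"

definition Top :: "('u::universe topology, 'u \<Rightarrow> 'u) cat" where
  "Top = \<lparr>Obj = {X. small (topspace X)},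
          Hom = (\<lambda>X Y. {f. continuous_map X Y f \<and> f \<in> extensional (topspace X)}),
          Cmp = (\<lambda>X Y Z g f. compose (topspace X) g f),
          Idt = (\<lambda>X. restrict (\<lambda>x. x) (topspace X))\<rparr>"

definition Top0 :: "('u::universe topology, 'u \<Rightarrow> 'u) cat" where
  "Top0 = full_sub Top {X. t0_space X}"

definition Sierpinski :: "'u::universe topology" where
  "Sierpinski = topology (\<lambda>U. U \<in> {{}, {1}, {0, 1}})"


section \<open>PFC-categories\<close>

record ('o, 'u) pfc =
  Cat :: "('o, 'u) cat"
  Ofun :: "('o, 'u, 'u gorder, 'u \<Rightarrow> 'u) fctr"
  two :: 'o
  iota :: "'u \<Rightarrow> 'u"

definition pfc_category :: "('o, 'u::universe) pfc \<Rightarrow> bool" where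
  "pfc_category P \<longleftrightarrow>
    is_functor (Cat P) Frm (Ofun P) \<and> faithful (Cat P) (Ofun P) \<and>
    two P \<in> Obj (Cat P) \<and> iso_arr Frm (fobj (Ofun P) (two P)) frame2 (iota P)"

abbreviation und :: "('o, 'u::universe) pfc \<Rightarrow> 'o \<Rightarrow> 'u set" where
  "und P C \<equiv> carrier (fobj (Ofun P) C)"

text \<open>
  Lifts and cartesian lifts are taken with respect to the underlying-set functor \<open>|O(-)|\<close>. A
  function on underlying sets is an arbitrary HOL function of which only the values on the
  underlying set of its domain matter; likewise for the bijection \<open>\<theta>\<close>.
\<close>

definition is_lift :: "('o, 'u::universe) pfc \<Rightarrow> 'o \<Rightarrow> 'o \<Rightarrow> ('u \<Rightarrow> 'u) \<Rightarrow> 'u \<Rightarrow> bool" where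
  "is_lift P A B h p \<longleftrightarrow> p \<in> Hom (Cat P) A B \<and> (\<forall>a\<in>und P A. farr (Ofun P) A B p a = h a)"

definition lifts :: "('o, 'u::universe) pfc \<Rightarrow> 'o \<Rightarrow> 'o \<Rightarrow> ('u \<Rightarrow> 'u) \<Rightarrow> bool" where
  "lifts P A B h \<longleftrightarrow> (\<exists>p. is_lift P A B h p)"

definition lift_of :: "('o, 'u::universe) pfc \<Rightarrow> 'o \<Rightarrow> 'o \<Rightarrow> ('u \<Rightarrow> 'u) \<Rightarrow> 'u" where
  "lift_of P A B h = (THE p. is_lift P A B h p)"

text \<open>
  \<open>cartesian_lift P S C I f E \<theta>\<close>: the pair \<open>(E, \<theta>)\<close> is a cartesian lift of the family
  of functions \<open>f i : S \<rightarrow> |O(C)|\<close>, \<open>i \<in> I\<close>.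
\<close>

definition cartesian_lift ::
  "('o, 'u::universe) pfc \<Rightarrow> 's set \<Rightarrow> 'o \<Rightarrow> 'i set \<Rightarrow> ('i \<Rightarrow> 's \<Rightarrow> 'u) \<Rightarrow> 'o \<Rightarrow> ('u \<Rightarrow> 's) \<Rightarrow> bool"
where
  "cartesian_lift P S C I f E \<theta> \<longleftrightarrow>
    E \<in> Obj (Cat P) \<and> bij_betw \<theta> (und P E) S \<and>
    (\<forall>D\<in>Obj (Cat P). \<forall>h \<in> und P D \<rightarrow> und P E.
       lifts P D E h \<longleftrightarrow> (\<forall>i\<in>I. lifts P D C (f i \<circ> \<theta> \<circ> h)))"

definition iota_inv :: "('o, 'u::universe) pfc \<Rightarrow> 'u \<Rightarrow> 'u" where
  "iota_inv P = inv_into (und P (two P)) (iota P)"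

definition chi :: "'u \<Rightarrow> ('u \<Rightarrow> 'u) \<Rightarrow> 'u" where
  "chi x g = g x"

definition Omega_lift ::
  "('o, 'u::universe) pfc \<Rightarrow> 'u topology \<Rightarrow> 'o \<Rightarrow> ('u \<Rightarrow> 'u \<Rightarrow> 'u) \<Rightarrow> bool" where
  "Omega_lift P X E \<theta> \<longleftrightarrow>
    cartesian_lift P (Hom Top X Sierpinski) (two P) (topspace X) (\<lambda>x. iota_inv P \<circ> chi x) E \<theta>"

definition TopC :: "('o, 'u::universe) pfc \<Rightarrow> ('u topology, 'u \<Rightarrow> 'u) cat" where
  "TopC P = full_sub Top {X. \<exists>E \<theta>. Omega_lift P X E \<theta>}"

text \<open>A cartesian lift is unique only up to isomorphism; one is fixed for each space.\<close>

definition Omega_choice :: "('o, 'u::universe) pfc \<Rightarrow> 'u topology \<Rightarrow> 'o \<times> ('u \<Rightarrow> 'u \<Rightarrow> 'u)" where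
  "Omega_choice P X = (SOME (E, \<theta>). Omega_lift P X E \<theta>)"

definition Omega :: "('o, 'u::universe) pfc \<Rightarrow> 'u topology \<Rightarrow> 'o" where
  "Omega P X = fst (Omega_choice P X)"

definition theta :: "('o, 'u::universe) pfc \<Rightarrow> 'u topology \<Rightarrow> 'u \<Rightarrow> 'u \<Rightarrow> 'u" where
  "theta P X = snd (Omega_choice P X)"

definition theta_inv :: "('o, 'u::universe) pfc \<Rightarrow> 'u topology \<Rightarrow> ('u \<Rightarrow> 'u) \<Rightarrow> 'u" where
  "theta_inv P X = inv_into (und P (Omega P X)) (theta P X)"

definition chi_bar :: "('o, 'u::universe) pfc \<Rightarrow> 'u topology \<Rightarrow> 'u \<Rightarrow> 'u" where
  "chi_bar P X x = lift_of P (Omega P X) (two P) (iota_inv P \<circ> chi x \<circ> theta P X)"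

definition pt :: "('o, 'u::universe) pfc \<Rightarrow> 'o \<Rightarrow> 'u topology" where
  "pt P C = topology (\<lambda>U. \<exists>a\<in>und P C.
     U = {f \<in> Hom (Cat P) C (two P). iota P (farr (Ofun P) C (two P) f a) = 1})"

definition sfc_category :: "('o, 'u::universe) pfc \<Rightarrow> bool" where
  "sfc_category P \<longleftrightarrow> pfc_category P \<and> Sierpinski \<in> Obj (TopC P) \<and>
    (\<forall>C\<in>Obj (Cat P). pt P C \<in> Obj (TopC P))"


section \<open>The dual adjunction of an SFC-category\<close>

definition pt_functor :: "('o, 'u::universe) pfc \<Rightarrow> ('o, 'u, 'u topology, 'u \<Rightarrow> 'u) fctr" where
  "pt_functor P = \<lparr>fobj = pt P,
     farr = (\<lambda>C D p. restrict (\<lambda>g. Cmp (Cat P) C D (two P) g p) (Hom (Cat P) D (two P)))\<rparr>"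

text \<open>The domain of \<open>Omega_functor P\<close> is the opposite of \<open>TopC P\<close>: \<open>f\<close> is a map \<open>Y \<rightarrow> X\<close>.\<close>

definition Omega_functor :: "('o, 'u::universe) pfc \<Rightarrow> ('u topology, 'u \<Rightarrow> 'u, 'o, 'u) fctr" where
  "Omega_functor P = \<lparr>fobj = Omega P,
     farr = (\<lambda>X Y f. lift_of P (Omega P X) (Omega P Y)
        (\<lambda>a. theta_inv P Y (compose (topspace Y) (theta P X a) f)))\<rparr>"

definition sigma :: "('o, 'u::universe) pfc \<Rightarrow> 'u topology \<Rightarrow> 'u \<Rightarrow> 'u" where
  "sigma P X = restrict (chi_bar P X) (topspace X)"

definition eta :: "('o, 'u::universe) pfc \<Rightarrow> 'o \<Rightarrow> 'u" where
  "eta P C = lift_of P C (Omega P (pt P C))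
     (\<lambda>a. theta_inv P (pt P C)
        (restrict (\<lambda>f. iota P (farr (Ofun P) C (two P) f a)) (Hom (Cat P) C (two P))))"

text \<open>An adjunction between \<open>Cat P\<close> and \<open>op_cat (TopC P)\<close>; its counit is \<open>\<sigma>\<close> read backwards.\<close>

definition dual_adj :: "('o, 'u::universe) pfc \<Rightarrow> ('o, 'u, 'u topology, 'u \<Rightarrow> 'u) adj" where
  "dual_adj P = \<lparr>ladj = pt_functor P, radj = Omega_functor P, unit = eta P, counit = sigma P\<rparr>"

definition FixTop :: "('o, 'u::universe) pfc \<Rightarrow> ('u topology, 'u \<Rightarrow> 'u) cat" where
  "FixTop P = full_sub (TopC P) {X. homeomorphic_map X (pt P (Omega P X)) (sigma P X)}"


section \<open>SFC-functors\<close>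

definition sfc_functor ::
  "('o, 'u::universe) pfc \<Rightarrow> ('p, 'u) pfc \<Rightarrow> ('o, 'u, 'p, 'u) fctr \<Rightarrow> ('o \<Rightarrow> 'u \<Rightarrow> 'u) \<Rightarrow> 'u \<Rightarrow> bool"
where
  "sfc_functor P Q H \<alpha> i \<longleftrightarrow>
    is_functor (Cat P) (Cat Q) H \<and>
    nat_iso (Cat P) Frm (fcomp (Ofun Q) H) (Ofun P) \<alpha> \<and>
    iso_arr (Cat Q) (fobj H (two P)) (two Q) i \<and>
    Cmp Frm (fobj (Ofun Q) (fobj H (two P))) (fobj (Ofun Q) (two Q)) frame2
        (iota Q) (farr (Ofun Q) (fobj H (two P)) (two Q) i) =
    Cmp Frm (fobj (Ofun Q) (fobj H (two P))) (fobj (Ofun P) (two P)) frame2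
        (iota P) (\<alpha> (two P)) \<and>
    (\<forall>X\<in>Obj (TopC P).
       cartesian_lift Q (Hom Top X Sierpinski) (fobj H (two P)) (topspace X)
         (\<lambda>x. inv_into (und Q (fobj H (two P))) (\<alpha> (two P)) \<circ> iota_inv P \<circ> chi x)
         (fobj H (Omega P X)) (theta P X \<circ> \<alpha> (Omega P X)))"

definition Dual ::
  "('o, 'u::universe) pfc \<Rightarrow> ('p, 'u) pfc \<Rightarrow> ('o, 'u, 'p, 'u) fctr \<Rightarrow> ('o \<Rightarrow> 'u \<Rightarrow> 'u) \<Rightarrow> 'u \<Rightarrow>
   ('o, 'u, 'u topology, 'u \<Rightarrow> 'u, 'p, 'u, 'u topology, 'u \<Rightarrow> 'u) adj_mor" where
  "Dual P Q H \<alpha> i = \<lparr>lfun = H, rfun = incl,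
     zeta = (\<lambda>X. lift_of Q (fobj H (Omega P X)) (Omega Q X)
               (\<lambda>a. theta_inv Q X (theta P X (\<alpha> (Omega P X) a)))),
     xi = (\<lambda>C. restrict
               (\<lambda>f. Cmp (Cat Q) (fobj H C) (fobj H (two P)) (two Q) i (farr H C (two P) f))
               (Hom (Cat P) C (two P)))\<rparr>"


section \<open>Fibers and totality\<close>

definition fiber :: "('o, 'u::universe) pfc \<Rightarrow> 'u gorder \<Rightarrow> ('o \<times> ('u \<Rightarrow> 'u)) set" where
  "fiber P L = {(C, t). C \<in> Obj (Cat P) \<and> iso_arr Frm (fobj (Ofun P) C) L t}"

definition fiber_le ::
  "('o, 'u::universe) pfc \<Rightarrow> 'u gorder \<Rightarrow> 'o \<times> ('u \<Rightarrow> 'u) \<Rightarrow> 'o \<times> ('u \<Rightarrow> 'u) \<Rightarrow> bool" where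
  "fiber_le P L = (\<lambda>(C, s) (D, t). \<exists>p\<in>Hom (Cat P) C D.
     Cmp Frm (fobj (Ofun P) C) (fobj (Ofun P) D) L t (farr (Ofun P) C D p) = s)"

definition fiber_initial :: "('o, 'u::universe) pfc \<Rightarrow> 'o \<Rightarrow> bool" where
  "fiber_initial P C \<longleftrightarrow> C \<in> Obj (Cat P) \<and>
    (let L = fobj (Ofun P) C in \<forall>y\<in>fiber P L. fiber_le P L (C, Idt Frm L) y)"

definition fiber_terminal :: "('o, 'u::universe) pfc \<Rightarrow> 'o \<Rightarrow> bool" where
  "fiber_terminal P C \<longleftrightarrow> C \<in> Obj (Cat P) \<and>
    (let L = fobj (Ofun P) C in \<forall>y\<in>fiber P L. fiber_le P L y (C, Idt Frm L))"

definition pfcT :: "('o, 'u::universe) pfc \<Rightarrow> ('o, 'u) pfc" where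
  "pfcT P = \<lparr>Cat = full_sub (Cat P) {C. fiber_terminal P C},
             Ofun = fcomp (Ofun P) incl, two = two P, iota = iota P\<rparr>"

definition total_sfc_category :: "('o, 'u::universe) pfc \<Rightarrow> bool" where
  "total_sfc_category P \<longleftrightarrow> sfc_category P \<and>
    (TopC P = Top \<and> FixTop P = Top0) \<and>
    (fiber_initial P (two P) \<and> fiber_terminal P (two P) \<and>
     fiber_initial P (Omega P Sierpinski) \<and> fiber_terminal P (Omega P Sierpinski)) \<and>
    (\<exists>J. adjunction Frm (Cat P) J \<and> radj J = Ofun P \<and>
         nat_iso Frm Frm incl (fcomp (radj J) (ladj J)) (unit J)) \<and>
    (\<forall>C\<in>Obj (Cat (pfcT P)). pt P C \<in> Obj (TopC (pfcT P)))"

end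

theory Submission
  imports Defs
begin

text \<open>
  Call a pair \<open>(E, \<theta>)\<close> an \<open>\<Omega>\<close>-lift of a space \<open>X\<close> if it is a cartesian lift of the evaluations at
  the points of \<open>X\<close>. All three claims rest on a comparison of \<open>\<Omega>\<close>-lifts taken among the
  fiber-terminal objects with \<open>\<Omega>\<close>-lifts taken in the whole category.

  One direction is immediate: an \<open>\<Omega>\<close>-lift in the whole category whose object is fiber-terminal
  is also one in the full subcategory (\<open>Omega_lift_pfcT\<close>). Applied to the Sierpinski space,
  whose \<open>\<Omega>\<close> is fiber-terminal, this makes the fiber-terminal objects an SFC-category; that their
  spaces of points have \<open>\<Omega>\<close>-lifts is part of totality.

  The converse is the heart of the matter (\<open>Omega_lift_of_pfcT\<close>). Let \<open>(E, \<theta>)\<close> be an \<open>\<Omega>\<close>-lift of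
  \<open>X\<close> among the fiber-terminal objects. As \<open>X\<close> has an \<open>\<Omega>\<close>-lift \<open>\<Omega>X\<close> in the whole category, its
  universal property gives a comparison arrow \<open>p : E \<rightarrow> \<Omega>X\<close> compatible with the two bijections.
  Hence \<open>O(p)\<close> is a bijective frame homomorphism, that is, an isomorphism of frames, and \<open>\<Omega>X\<close>
  together with \<open>O(p)\<inverse>\<close> lies in the fiber over \<open>O(E)\<close>. Since \<open>E\<close> is a top element of that fiber,
  there is \<open>q : \<Omega>X \<rightarrow> E\<close> over \<open>O(p)\<inverse>\<close> (\<open>fiber_terminal_retraction\<close>). Every arrow into \<open>\<Omega>X\<close> can
  therefore be transported along \<open>q\<close>, and \<open>E\<close> inherits the universal property of \<open>\<Omega>X\<close>. This says
  that the inclusion is an SFC-functor.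

  For the third claim, every SFC-category has a dual adjunction (\<open>adjunction_dual\<close>) and every
  SFC-functor induces a right adjunction morphism between them (\<open>right_adj_morphism_Dual\<close>). Both
  are obtained by evaluating all arrows on underlying sets, which is legitimate because the functor
  to frames is faithful and \<open>\<theta>\<close> is injective; \<open>\<zeta>\<close> is invertible since it compares two \<open>\<Omega>\<close>-lifts of
  the same space. For the inclusion of the fiber-terminal objects the component of \<open>\<xi>\<close> at \<open>C\<close>
  composes \<open>f : C \<rightarrow> 2\<close> with an identity, so it is the identity of \<open>pt(C)\<close> and the morphism is strong.
\<close>


section \<open>Categories and functors\<close>

lemma op_cat_simps [simp]:
  "Obj (op_cat K) = Obj K" "Hom (op_cat K) A B = Hom K B A"
  "Cmp (op_cat K) A B C g f = Cmp K C B A f g" "Idt (op_cat K) = Idt K"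
  by (simp_all add: op_cat_def)

lemma full_sub_simps [simp]:
  "Obj (full_sub K S) = Obj K \<inter> S" "Hom (full_sub K S) = Hom K"
  "Cmp (full_sub K S) = Cmp K" "Idt (full_sub K S) = Idt K"
  by (simp_all add: full_sub_def)

lemma incl_simps [simp]: "fobj incl A = A" "farr incl A B f = f"
  by (simp_all add: incl_def)

lemma fcomp_simps [simp]:
  "fobj (fcomp G F) A = fobj G (fobj F A)"
  "farr (fcomp G F) A B f = farr G (fobj F A) (fobj F B) (farr F A B f)"
  by (simp_all add: fcomp_def)

lemma fcomp_incl [simp]: "fcomp F incl = (F :: ('o, 'm, 'p, 'n) fctr)"
  by (simp add: fcomp_def incl_def)

lemma category_op_cat: "category K \<Longrightarrow> category (op_cat K)"
  unfolding category_def by simp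

lemma category_full_sub: "category K \<Longrightarrow> category (full_sub K S)"
  unfolding category_def by simp

lemma is_functor_full_sub: "is_functor K L F \<Longrightarrow> is_functor (full_sub K S) L F"
  unfolding is_functor_def by (simp add: category_full_sub)

lemma is_functor_incl:
  assumes "category K" "category L" "Obj K \<subseteq> Obj L" "Hom K = Hom L" "Cmp K = Cmp L" "Idt K = Idt L"
  shows "is_functor K L incl"
  using assms unfolding is_functor_def category_def by auto

lemma is_functor_fcomp: "is_functor K L F \<Longrightarrow> is_functor L M G \<Longrightarrow> is_functor K M (fcomp G F)"
  unfolding is_functor_def by simp

lemma iso_arr_op_cat [simp]: "iso_arr (op_cat K) A B f \<longleftrightarrow> iso_arr K B A f"
  by (auto simp: iso_arr_def)

lemma iso_arr_Idt: "category K \<Longrightarrow> A \<in> Obj K \<Longrightarrow> iso_arr K A A (Idt K A)"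
  by (auto simp: iso_arr_def category_def)


section \<open>Topological spaces and the Sierpinski space\<close>

lemma Top_simps [simp]:
  "Obj Top = {X. small (topspace X)}"
  "Hom Top X Y = {f. continuous_map X Y f \<and> f \<in> extensional (topspace X)}"
  "Cmp Top X Y Z g f = compose (topspace X) g f"
  "Idt Top X = restrict (\<lambda>x. x) (topspace X)"
  by (simp_all add: Top_def)

lemma Top_Cmp_closed:
  "f \<in> Hom Top X Y \<Longrightarrow> g \<in> Hom Top Y Z \<Longrightarrow> compose (topspace X) g f \<in> Hom Top X Z"
  by (auto simp: compose_def intro!: continuous_map_eq[OF continuous_map_compose[of X Y f Z g]])

lemma category_Top: "category (Top :: ('u::universe topology, 'u \<Rightarrow> 'u) cat)"
proof -
  have Id: "Idt Top X \<in> Hom Top X X" for X :: "'u topology"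
    by (auto intro!: continuous_map_eq[OF continuous_map_id])
  have Cmp: "Cmp Top X Y Z g f \<in> Hom Top X Z" if "f \<in> Hom Top X Y" "g \<in> Hom Top Y Z"
    for X Y Z :: "'u topology" and f g
    using Top_Cmp_closed[OF that] by simp
  have unit: "Cmp Top X X Y f (Idt Top X) = f \<and> Cmp Top X Y Y (Idt Top Y) f = f"
    if "f \<in> Hom Top X Y" for X Y :: "'u topology" and f
    using that by (auto simp: compose_def extensional_def continuous_map_def fun_eq_iff)
  have assoc: "Cmp Top X Y W (Cmp Top Y Z W h g) f = Cmp Top X Z W h (Cmp Top X Y Z g f)"
    if "f \<in> Hom Top X Y" for X Y Z W :: "'u topology" and f g h
    using that by (auto simp: compose_def continuous_map_def fun_eq_iff)
  show ?thesis
    unfolding category_def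
    by (intro conjI[of "\<forall>A\<in>_. _ A"] conjI ballI Id) (erule (1) Cmp, erule unit[THEN conjunct1], erule unit[THEN conjunct2], erule assoc)
qed

lemma Top_arr_in: "f \<in> Hom Top X Y \<Longrightarrow> x \<in> topspace X \<Longrightarrow> f x \<in> topspace Y"
  by (auto simp: continuous_map_def)

lemma openin_Sierpinski: "openin Sierpinski U \<longleftrightarrow> U = {} \<or> U = {1} \<or> U = {0, 1 :: 'u::universe}"
proof -
  have "istopology (\<lambda>U. U \<in> {{}, {1}, {0, 1 :: 'u}})"
    unfolding istopology_def
  proof (intro conjI allI impI)
    fix S T :: "'u set" assume "S \<in> {{}, {1}, {0, 1}}" "T \<in> {{}, {1}, {0, 1}}"
    then show "S \<inter> T \<in> {{}, {1}, {0, 1}}" by (elim insertE emptyE) simp_all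
  next
    fix K :: "'u set set" assume "\<forall>S\<in>K. S \<in> {{}, {1}, {0, 1}}"
    then have K: "S = {} \<or> S = {1} \<or> S = {0, 1}" if "S \<in> K" for S using that by simp
    then have sub: "\<Union>K \<subseteq> {0, 1}" by blast
    have "1 \<in> \<Union>K" if 0: "0 \<in> \<Union>K"
    proof -
      obtain S where "S \<in> K" "0 \<in> S" using 0 by blast
      then have "S = {0, 1}" using K[of S] by auto
      then show ?thesis using \<open>S \<in> K\<close> by blast
    qed
    then have "\<Union>K = {0, 1} \<or> \<Union>K = {1} \<or> \<Union>K = {}"
      using sub by (cases "0 \<in> \<Union>K"; cases "1 \<in> \<Union>K") (blast | fast)+
    then show "\<Union>K \<in> {{}, {1}, {0, 1}}" by (elim disjE) simp_all
  qed
  then show ?thesis by (simp add: Sierpinski_def)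
qed

lemma topspace_Sierpinski [simp]: "topspace Sierpinski = {0, 1 :: 'u::universe}"
proof
  show "topspace Sierpinski \<subseteq> {0, 1 :: 'u}"
    using openin_topspace[of "Sierpinski :: 'u topology"] unfolding openin_Sierpinski by fast
  show "{0, 1 :: 'u} \<subseteq> topspace Sierpinski"
    by (rule openin_subset) (simp add: openin_Sierpinski)
qed

lemma continuous_map_Sierpinski:
  "continuous_map X Sierpinski g \<longleftrightarrow>
     g \<in> topspace X \<rightarrow> {0, 1} \<and> openin X {x \<in> topspace X. g x = (1 :: 'u::universe)}"
proof
  assume g: "continuous_map X Sierpinski g"
  have "openin X {x \<in> topspace X. g x \<in> {1}}"
    using g by (rule openin_continuous_map_preimage) (simp add: openin_Sierpinski)
  then show "g \<in> topspace X \<rightarrow> {0, 1} \<and> openin X {x \<in> topspace X. g x = 1}"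
    using continuous_map_funspace[OF g] by simp
next
  assume g: "g \<in> topspace X \<rightarrow> {0, 1} \<and> openin X {x \<in> topspace X. g x = 1}"
  have "openin X {x \<in> topspace X. g x \<in> U}" if "openin Sierpinski U" for U
  proof -
    have "{x \<in> topspace X. g x \<in> {0, 1}} = topspace X" using g by (auto simp: Pi_iff)
    then show ?thesis
      using that g unfolding openin_Sierpinski by (elim disjE) simp_all
  qed
  then show "continuous_map X Sierpinski g"
    using g unfolding continuous_map_def by simp
qed


section \<open>Frames\<close>

lemma Frm_simps [simp]:
  "Hom Frm L M = {f. frame_hom L M f \<and> f \<in> extensional (carrier L)}"
  "Cmp Frm L M N g f = compose (carrier L) g f"
  "Idt Frm L = restrict (\<lambda>a. a) (carrier L)"
  by (simp_all add: Frm_def)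

lemma frame_hom_in: "frame_hom L M f \<Longrightarrow> a \<in> carrier L \<Longrightarrow> f a \<in> carrier M"
  by (auto simp: frame_hom_def)

lemma Frm_iso_arr_bij:
  assumes "iso_arr Frm L M f" shows "bij_betw f (carrier L) (carrier M)"
proof -
  obtain g where g: "frame_hom M L g" "compose (carrier L) g f = restrict (\<lambda>a. a) (carrier L)"
    "compose (carrier M) f g = restrict (\<lambda>a. a) (carrier M)" and f: "frame_hom L M f"
    using assms by (auto simp: iso_arr_def)
  show ?thesis
  proof (rule bij_betwI[where g = g])
    show "g (f x) = x" if "x \<in> carrier L" for x
      using fun_cong[OF g(2), of x] that by (simp add: compose_def)
    show "f (g x) = x" if "x \<in> carrier M" for x
      using fun_cong[OF g(3), of x] that by (simp add: compose_def)
  qed (use f g in \<open>auto simp: frame_hom_def\<close>)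
qed

lemma frame_hom_inv_into:
  assumes f: "frame_hom L M f" and bij: "bij_betw f (carrier L) (carrier M)"
  shows "frame_hom M L (restrict (inv_into (carrier L) f) (carrier M))" (is "frame_hom M L ?g")
proof -
  interpret L: complete_lattice L using f by (simp add: frame_hom_def sup_pres_def)
  interpret M: complete_lattice M using f by (simp add: frame_hom_def sup_pres_def)
  have gin: "?g b \<in> carrier L" if "b \<in> carrier M" for b
    using that bij by (metis bij_betw_imp_surj_on inv_into_into restrict_apply')
  have fg: "f (?g b) = b" if "b \<in> carrier M" for b
    using that bij by (simp add: bij_betw_inv_into_right)
  have gf: "?g (f a) = a" if "a \<in> carrier L" for a
    using that bij f by (simp add: bij_betw_inv_into_left frame_hom_in)
  have sup: "?g (\<Squnion>\<^bsub>M\<^esub> B) = \<Squnion>\<^bsub>L\<^esub> (?g ` B)" if B: "B \<subseteq> carrier M" for B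
  proof -
    have sub: "?g ` B \<subseteq> carrier L" using gin B by blast
    have "f ` ?g ` B = (\<lambda>b. b) ` B"
      unfolding image_image by (rule image_cong[OF refl], rule fg) (use B in blast)
    then have "f (\<Squnion>\<^bsub>L\<^esub> (?g ` B)) = \<Squnion>\<^bsub>M\<^esub> B"
      using f sub by (simp add: frame_hom_def sup_pres_def del: image_image)
    then show ?thesis using gf[OF L.sup_closed[OF sub]] by simp
  qed
  have meet: "?g (a \<sqinter>\<^bsub>M\<^esub> b) = ?g a \<sqinter>\<^bsub>L\<^esub> ?g b" if "a \<in> carrier M" "b \<in> carrier M" for a b
  proof -
    have "f (?g a \<sqinter>\<^bsub>L\<^esub> ?g b) = a \<sqinter>\<^bsub>M\<^esub> b"
      using f gin[OF that(1)] gin[OF that(2)] fg that by (simp add: frame_hom_def meet_pres_def)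
    then show ?thesis using gf[OF L.meet_closed[OF gin[OF that(1)] gin[OF that(2)]]] by simp
  qed
  have "?g \<top>\<^bsub>M\<^esub> = \<top>\<^bsub>L\<^esub>"
    using f gf[OF L.top_closed] by (simp add: frame_hom_def)
  then show ?thesis
    unfolding frame_hom_def sup_pres_def meet_pres_def
    by (intro conjI allI ballI impI funcsetI gin sup meet L.complete_lattice_axioms
        M.complete_lattice_axioms L.lattice_axioms M.lattice_axioms)
qed

text \<open>As for any algebraic structure, the isomorphisms of frames are the bijective homomorphisms.\<close>

lemma Frm_iso_arr_iff_bij:
  assumes "f \<in> Hom Frm L M"
  shows "iso_arr Frm L M f \<longleftrightarrow> bij_betw f (carrier L) (carrier M)"
proof
  assume bij: "bij_betw f (carrier L) (carrier M)"
  let ?g = "restrict (inv_into (carrier L) f) (carrier M)"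
  have "?g \<in> Hom Frm M L"
    using assms bij frame_hom_inv_into by auto
  moreover have "compose (carrier L) ?g f = restrict (\<lambda>a. a) (carrier L)"
    using assms bij by (auto simp: compose_def bij_betw_inv_into_left frame_hom_in)
  moreover have "compose (carrier M) f ?g = restrict (\<lambda>a. a) (carrier M)"
    using bij by (auto simp: compose_def bij_betw_inv_into_right)
  ultimately show "iso_arr Frm L M f"
    using assms unfolding iso_arr_def by auto
qed (rule Frm_iso_arr_bij)

text \<open>The operations of \<open>2\<close>, as far as they are needed to recognise when a value is \<open>1\<close>.\<close>

lemma frame2_top:
  assumes "Complete_Lattice.complete_lattice (frame2 :: 'u::universe gorder)"
  shows "\<top>\<^bsub>frame2\<^esub> = (1 :: 'u)"
proof -
  interpret complete_lattice "frame2 :: 'u gorder" by fact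
  have "(1 :: 'u) \<sqsubseteq>\<^bsub>frame2\<^esub> \<top>\<^bsub>frame2\<^esub>" by (rule top_higher) (simp add: frame2_def)
  then show ?thesis by (simp add: frame2_def)
qed

lemma frame2_meet:
  assumes "Complete_Lattice.complete_lattice (frame2 :: 'u::universe gorder)"
    and ab: "a \<in> {0, 1 :: 'u}" "b \<in> {0, 1}"
  shows "a \<sqinter>\<^bsub>frame2\<^esub> b = 1 \<longleftrightarrow> a = 1 \<and> b = 1"
proof -
  interpret complete_lattice "frame2 :: 'u gorder" by fact
  have c: "a \<in> carrier frame2" "b \<in> carrier frame2" "1 \<in> carrier frame2"
    using ab by (auto simp: frame2_def)
  have le: "x \<sqsubseteq>\<^bsub>frame2\<^esub> y \<longleftrightarrow> x = 0 \<or> y = 1" for x y :: 'u by (simp add: frame2_def)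
  show ?thesis
    using meet_left[OF c(1,2)] meet_right[OF c(1,2)] meet_le[OF _ _ c(3) c(1,2)]
    by (auto simp: le)
qed

lemma frame2_sup:
  assumes "Complete_Lattice.complete_lattice (frame2 :: 'u::universe gorder)"
    and B: "B \<subseteq> {0, 1 :: 'u}"
  shows "\<Squnion>\<^bsub>frame2\<^esub> B = 1 \<longleftrightarrow> 1 \<in> B"
proof -
  interpret complete_lattice "frame2 :: 'u gorder" by fact
  have c: "B \<subseteq> carrier frame2" "(0::'u) \<in> carrier frame2" "(1::'u) \<in> carrier frame2"
    using B by (auto simp: frame2_def)
  have le: "x \<sqsubseteq>\<^bsub>frame2\<^esub> y \<longleftrightarrow> x = 0 \<or> y = 1" for x y :: 'u by (simp add: frame2_def)
  have "\<Squnion>\<^bsub>frame2\<^esub> B = 1" if "1 \<in> B"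
    using sup_upper[OF c(1) that] by (simp add: le)
  moreover have "\<Squnion>\<^bsub>frame2\<^esub> B = 0" if "1 \<notin> B"
  proof -
    have "B \<subseteq> {0}" using B that by auto
    then have "\<Squnion>\<^bsub>frame2\<^esub> B \<sqsubseteq>\<^bsub>frame2\<^esub> 0"
      by (intro sup_least c) (auto simp: le)
    then show ?thesis by (simp add: le)
  qed
  ultimately show ?thesis by (cases "1 \<in> B") simp_all
qed


section \<open>Lifts and points in a PFC-category\<close>

lemma Omega_lift_in_TopC: "X \<in> Obj (TopC P) \<Longrightarrow> Omega_lift P X (Omega P X) (theta P X)"
proof -
  assume "X \<in> Obj (TopC P)"
  then have "\<exists>p. (case p of (E, \<theta>) \<Rightarrow> Omega_lift P X E \<theta>)" by (auto simp: TopC_def)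
  then have "case Omega_choice P X of (E, \<theta>) \<Rightarrow> Omega_lift P X E \<theta>"
    unfolding Omega_choice_def by (rule someI_ex)
  then show ?thesis by (simp add: Omega_def theta_def case_prod_beta')
qed

lemma TopC_I: "X \<in> Obj Top \<Longrightarrow> Omega_lift P X E \<theta> \<Longrightarrow> X \<in> Obj (TopC P)"
  unfolding TopC_def by auto

lemma lifts_cong: "(\<And>a. a \<in> und P A \<Longrightarrow> h a = k a) \<Longrightarrow> lifts P A B h \<longleftrightarrow> lifts P A B k"
  unfolding lifts_def is_lift_def by simp

lemma cartesian_lift_cong:
  assumes "\<And>i s. i \<in> I \<Longrightarrow> s \<in> S \<Longrightarrow> f i s = g i s" "\<And>a. a \<in> und P E \<Longrightarrow> \<theta> a = \<theta>' a"
  shows "cartesian_lift P S C I f E \<theta> \<longleftrightarrow> cartesian_lift P S C I g E \<theta>'"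
proof -
  have "(lifts P D E h \<longleftrightarrow> (\<forall>i\<in>I. lifts P D C (f i \<circ> \<theta> \<circ> h))) \<longleftrightarrow>
        (lifts P D E h \<longleftrightarrow> (\<forall>i\<in>I. lifts P D C (g i \<circ> \<theta>' \<circ> h)))"
    if "h \<in> und P D \<rightarrow> und P E" "bij_betw \<theta> (und P E) S" for D h
  proof -
    have "lifts P D C (f i \<circ> \<theta> \<circ> h) \<longleftrightarrow> lifts P D C (g i \<circ> \<theta>' \<circ> h)" if "i \<in> I" for i
    proof (rule lifts_cong)
      fix a assume "a \<in> und P D"
      then have "h a \<in> und P E" "\<theta> (h a) \<in> S"
        using \<open>h \<in> _\<close> \<open>bij_betw \<theta> _ _\<close> by (auto simp: bij_betw_def)
      then show "(f i \<circ> \<theta> \<circ> h) a = (g i \<circ> \<theta>' \<circ> h) a"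
        using assms \<open>i \<in> I\<close> by simp
    qed
    then show ?thesis by simp
  qed
  moreover have "bij_betw \<theta> (und P E) S \<longleftrightarrow> bij_betw \<theta>' (und P E) S"
    using assms(2) by (rule bij_betw_cong)
  ultimately show ?thesis
    unfolding cartesian_lift_def by (metis (lifting))
qed

text \<open>The action of an arrow \<open>p : A \<rightarrow> B\<close> on underlying sets.\<close>

abbreviation act :: "('o, 'u::universe) pfc \<Rightarrow> 'o \<Rightarrow> 'o \<Rightarrow> 'u \<Rightarrow> 'u \<Rightarrow> 'u" where
  "act P A B p \<equiv> farr (Ofun P) A B p"

text \<open>
  An element \<open>a\<close> of \<open>O(C)\<close>, seen as the map \<open>f \<mapsto> \<iota>(O f(a))\<close> from \<open>pt(C)\<close> to the Sierpinski space.
  The opens of \<open>pt(C)\<close> are the preimages of \<open>1\<close> under these maps.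
\<close>

definition evaluation :: "('o, 'u::universe) pfc \<Rightarrow> 'o \<Rightarrow> 'u \<Rightarrow> 'u \<Rightarrow> 'u" where
  "evaluation P C a = restrict (\<lambda>f. iota P (act P C (two P) f a)) (Hom (Cat P) C (two P))"

text \<open>PFC-categories; faithfulness of \<open>O\<close> is available as \<open>arr_eqI\<close>.\<close>

locale pfc =
  fixes P :: "('o, 'u::universe) pfc"
  assumes pfc: "pfc_category P"
begin

lemma functor_Ofun: "is_functor (Cat P) Frm (Ofun P)" and two_Obj: "two P \<in> Obj (Cat P)"
  and iota_iso: "iso_arr Frm (fobj (Ofun P) (two P)) frame2 (iota P)"
  using pfc by (auto simp: pfc_category_def)

lemma category_Cat: "category (Cat P)" and category_Frm: "category (Frm :: ('u gorder, 'u \<Rightarrow> 'u) cat)"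
  using functor_Ofun by (auto simp: is_functor_def)

lemma Cmp_Hom:
  assumes "A \<in> Obj (Cat P)" "B \<in> Obj (Cat P)" "C \<in> Obj (Cat P)"
    "f \<in> Hom (Cat P) A B" "g \<in> Hom (Cat P) B C"
  shows "Cmp (Cat P) A B C g f \<in> Hom (Cat P) A C"
  using category_Cat assms unfolding category_def by blast

lemma Idt_Hom: "A \<in> Obj (Cat P) \<Longrightarrow> Idt (Cat P) A \<in> Hom (Cat P) A A"
  using category_Cat unfolding category_def by blast

lemma act_Frm:
  assumes "A \<in> Obj (Cat P)" "B \<in> Obj (Cat P)" "p \<in> Hom (Cat P) A B"
  shows "act P A B p \<in> Hom Frm (fobj (Ofun P) A) (fobj (Ofun P) B)"
  using functor_Ofun assms unfolding is_functor_def by blast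

lemma act_in:
  assumes "A \<in> Obj (Cat P)" "B \<in> Obj (Cat P)" "p \<in> Hom (Cat P) A B" "a \<in> und P A"
  shows "act P A B p a \<in> und P B"
proof -
  have "frame_hom (fobj (Ofun P) A) (fobj (Ofun P) B) (act P A B p)"
    using act_Frm[OF assms(1-3)] by simp
  then show ?thesis using assms(4) by (rule frame_hom_in)
qed

lemma act_Cmp:
  assumes "A \<in> Obj (Cat P)" "B \<in> Obj (Cat P)" "C \<in> Obj (Cat P)"
    "f \<in> Hom (Cat P) A B" "g \<in> Hom (Cat P) B C" "a \<in> und P A"
  shows "act P A C (Cmp (Cat P) A B C g f) a = act P B C g (act P A B f a)"
  using functor_Ofun assms unfolding is_functor_def by (simp add: compose_def)

lemma act_Idt: "A \<in> Obj (Cat P) \<Longrightarrow> a \<in> und P A \<Longrightarrow> act P A A (Idt (Cat P) A) a = a"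
  using functor_Ofun unfolding is_functor_def by simp

lemma arr_eqI:
  assumes "A \<in> Obj (Cat P)" "B \<in> Obj (Cat P)" "p \<in> Hom (Cat P) A B" "q \<in> Hom (Cat P) A B"
    and "\<And>a. a \<in> und P A \<Longrightarrow> act P A B p a = act P A B q a"
  shows "p = q"
proof -
  have "act P A B p = act P A B q"
    using act_Frm[OF assms(1-3)] act_Frm[OF assms(1,2,4)] assms(5) by (auto intro: extensionalityI)
  then show ?thesis
    using pfc assms(1-4) unfolding pfc_category_def faithful_def inj_on_def by blast
qed

lemma is_lift_lift_of:
  assumes "A \<in> Obj (Cat P)" "B \<in> Obj (Cat P)" "lifts P A B h"
  shows "lift_of P A B h \<in> Hom (Cat P) A B"
    and "\<And>a. a \<in> und P A \<Longrightarrow> act P A B (lift_of P A B h) a = h a"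
proof -
  obtain p where p: "is_lift P A B h p" using assms(3) by (auto simp: lifts_def)
  have "is_lift P A B h (lift_of P A B h)"
    unfolding lift_of_def
  proof (rule theI[where P = "is_lift P A B h", OF p])
    fix q assume q: "is_lift P A B h q"
    show "q = p" by (rule arr_eqI[OF assms(1,2), of q p]) (use p q in \<open>simp_all add: is_lift_def\<close>)
  qed
  then show "lift_of P A B h \<in> Hom (Cat P) A B"
    and "\<And>a. a \<in> und P A \<Longrightarrow> act P A B (lift_of P A B h) a = h a"
    by (auto simp: is_lift_def)
qed

lemma lifts_act: "p \<in> Hom (Cat P) A B \<Longrightarrow> (\<And>a. a \<in> und P A \<Longrightarrow> act P A B p a = h a) \<Longrightarrow> lifts P A B h"
  by (auto simp: lifts_def is_lift_def)

lemma lifts_Cmp: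
  assumes "A \<in> Obj (Cat P)" "B \<in> Obj (Cat P)" "C \<in> Obj (Cat P)"
    "lifts P A B h" "lifts P B C k" "h \<in> und P A \<rightarrow> und P B"
  shows "lifts P A C (k \<circ> h)"
proof -
  obtain p q where "is_lift P A B h p" "is_lift P B C k q" using assms by (auto simp: lifts_def)
  then show ?thesis
    using assms by (intro lifts_act[of "Cmp (Cat P) A B C q p"]) (auto simp: is_lift_def Cmp_Hom act_Cmp)
qed

lemma iota_bij: "bij_betw (iota P) (und P (two P)) {0, 1}"
  using Frm_iso_arr_bij[OF iota_iso] by (simp add: frame2_def)

lemma iota_in: "a \<in> und P (two P) \<Longrightarrow> iota P a = 0 \<or> iota P a = 1"
  using iota_bij by (auto simp: bij_betw_def)

lemma iota_inv_in: "s = 0 \<or> s = 1 \<Longrightarrow> iota_inv P s \<in> und P (two P)"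
  unfolding iota_inv_def using iota_bij by (metis bij_betw_imp_surj_on inv_into_into insertCI)

lemma iota_iota_inv: "s = 0 \<or> s = 1 \<Longrightarrow> iota P (iota_inv P s) = s"
  unfolding iota_inv_def using iota_bij by (simp add: bij_betw_inv_into_right)

lemma iota_inv_iota: "a \<in> und P (two P) \<Longrightarrow> iota_inv P (iota P a) = a"
  unfolding iota_inv_def using iota_bij by (simp add: bij_betw_inv_into_left)

lemma evaluation_in:
  assumes "C \<in> Obj (Cat P)" "a \<in> und P C" "f \<in> Hom (Cat P) C (two P)"
  shows "iota P (act P C (two P) f a) = 0 \<or> iota P (act P C (two P) f a) = 1"
  using assms two_Obj by (intro iota_in act_in)

text \<open>
  The sets defining \<open>pt(C)\<close> form a topology because \<open>\<iota> \<circ> O(f)\<close> is a frame homomorphism to \<open>2\<close> for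
  every point \<open>f\<close>: finite meets and joins in \<open>O(C)\<close> become intersections and unions.
\<close>

lemma openin_pt:
  assumes C: "C \<in> Obj (Cat P)"
  shows "openin (pt P C) U \<longleftrightarrow>
    (\<exists>a\<in>und P C. U = {f \<in> Hom (Cat P) C (two P). iota P (act P C (two P) f a) = 1})"
proof -
  let ?D = "\<lambda>a. {f \<in> Hom (Cat P) C (two P). iota P (act P C (two P) f a) = 1}"
  have f: "frame_hom (fobj (Ofun P) C) (fobj (Ofun P) (two P)) (act P C (two P) f)"
    if "f \<in> Hom (Cat P) C (two P)" for f
    using act_Frm[OF C two_Obj that] by simp
  have i: "frame_hom (fobj (Ofun P) (two P)) frame2 (iota P)"
    using iota_iso by (simp add: iso_arr_def)
  \<comment> \<open>\<open>O(C)\<close> is a complete lattice, being the domain of a frame homomorphism.\<close>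
  have "Idt (Cat P) C \<in> Hom (Cat P) C C" using C by (rule Idt_Hom)
  then have "frame_hom (fobj (Ofun P) C) (fobj (Ofun P) C) (act P C C (Idt (Cat P) C))"
    using act_Frm[OF C C] by simp
  then interpret L: complete_lattice "fobj (Ofun P) C"
    by (simp add: frame_hom_def sup_pres_def)
  have cl2: "Complete_Lattice.complete_lattice (frame2 :: 'u gorder)"
    using i by (simp add: frame_hom_def sup_pres_def)
  have "istopology (\<lambda>U. \<exists>a\<in>und P C. U = ?D a)"
    unfolding istopology_def
  proof (intro conjI allI impI)
    fix S T assume "\<exists>a\<in>und P C. S = ?D a" "\<exists>a\<in>und P C. T = ?D a"
    then obtain a b where ab: "a \<in> und P C" "S = ?D a" "b \<in> und P C" "T = ?D b" by auto
    have "iota P (act P C (two P) f (a \<sqinter>\<^bsub>fobj (Ofun P) C\<^esub> b)) = 1 \<longleftrightarrow>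
        iota P (act P C (two P) f a) = 1 \<and> iota P (act P C (two P) f b) = 1"
      if "f \<in> Hom (Cat P) C (two P)" for f
    proof -
      have "iota P (act P C (two P) f (a \<sqinter>\<^bsub>fobj (Ofun P) C\<^esub> b)) =
        iota P (act P C (two P) f a) \<sqinter>\<^bsub>frame2\<^esub> iota P (act P C (two P) f b)"
        using f[OF that] i ab act_in[OF C two_Obj that] by (simp add: frame_hom_def meet_pres_def)
      then show ?thesis
        using frame2_meet[OF cl2] evaluation_in[OF C _ that] ab by auto
    qed
    then have "S \<inter> T = ?D (a \<sqinter>\<^bsub>fobj (Ofun P) C\<^esub> b)" using ab by auto
    then show "\<exists>a\<in>und P C. S \<inter> T = ?D a" by (rule bexI) (use ab in simp)
  next
    fix K assume K: "\<forall>S\<in>K. \<exists>a\<in>und P C. S = ?D a"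
    \<comment> \<open>All elements of \<open>O(C)\<close> whose basic set belongs to \<open>K\<close>; this avoids choosing one for each member.\<close>
    define B where "B = {a \<in> und P C. ?D a \<in> K}"
    have B: "B \<subseteq> und P C" by (auto simp: B_def)
    have "iota P (act P C (two P) f (\<Squnion>\<^bsub>fobj (Ofun P) C\<^esub> B)) = 1 \<longleftrightarrow> (\<exists>b\<in>B. iota P (act P C (two P) f b) = 1)"
      if "f \<in> Hom (Cat P) C (two P)" for f
    proof -
      have "act P C (two P) f ` B \<subseteq> und P (two P)" using B act_in[OF C two_Obj that] by auto
      then have "iota P (act P C (two P) f (\<Squnion>\<^bsub>fobj (Ofun P) C\<^esub> B)) =
        \<Squnion>\<^bsub>frame2\<^esub> (iota P ` act P C (two P) f ` B)"
        using f[OF that] i B by (simp add: frame_hom_def sup_pres_def)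
      moreover have "iota P ` act P C (two P) f ` B \<subseteq> {0, 1}"
        using evaluation_in[OF C _ that] B by auto
      ultimately show ?thesis
        using frame2_sup[OF cl2] by (auto simp: image_iff)
    qed
    then have "?D (\<Squnion>\<^bsub>fobj (Ofun P) C\<^esub> B) = (\<Union>b\<in>B. ?D b)" by auto
    also have "?D ` B = K"
    proof
      show "?D ` B \<subseteq> K" by (auto simp: B_def)
      show "K \<subseteq> ?D ` B"
      proof
        fix S assume S: "S \<in> K"
        then obtain a where a: "a \<in> und P C" "S = ?D a" using K by blast
        then have "a \<in> B" using S by (simp add: B_def)
        then show "S \<in> ?D ` B" using a(2) by (rule rev_image_eqI)
      qed
    qed
    finally have "\<Union>K = ?D (\<Squnion>\<^bsub>fobj (Ofun P) C\<^esub> B)" ..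
    then show "\<exists>a\<in>und P C. \<Union>K = ?D a" by (rule bexI) (use L.sup_closed[OF B] in simp)
  qed
  then show ?thesis unfolding pt_def by simp
qed

lemma topspace_pt:
  assumes C: "C \<in> Obj (Cat P)" shows "topspace (pt P C) = Hom (Cat P) C (two P)"
proof -
  have i: "frame_hom (fobj (Ofun P) (two P)) frame2 (iota P)"
    using iota_iso by (simp add: iso_arr_def)
  have "frame_hom (fobj (Ofun P) C) (fobj (Ofun P) C) (act P C C (Idt (Cat P) C))"
    using act_Frm[OF C C] Idt_Hom[OF C] by simp
  then interpret L: complete_lattice "fobj (Ofun P) C"
    by (simp add: frame_hom_def sup_pres_def)
  have "iota P (act P C (two P) f \<top>\<^bsub>fobj (Ofun P) C\<^esub>) = 1" if "f \<in> Hom (Cat P) C (two P)" for f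
    using act_Frm[OF C two_Obj that] i by (simp add: frame_hom_def sup_pres_def frame2_top)
  then have "openin (pt P C) (Hom (Cat P) C (two P))"
    unfolding openin_pt[OF C] using L.top_closed by (intro bexI[of _ "\<top>\<^bsub>fobj (Ofun P) C\<^esub>"]) auto
  then show ?thesis
    using openin_pt[OF C] by (auto simp: topspace_def)
qed

lemma evaluation_Hom:
  assumes "C \<in> Obj (Cat P)" "a \<in> und P C"
  shows "evaluation P C a \<in> Hom Top (pt P C) Sierpinski"
proof -
  have "{x \<in> Hom (Cat P) C (two P). evaluation P C a x = 1} =
    {f \<in> Hom (Cat P) C (two P). iota P (act P C (two P) f a) = 1}"
    by (auto simp: evaluation_def)
  then show ?thesis
    using assms evaluation_in[OF assms]
    by (auto simp: continuous_map_Sierpinski topspace_pt openin_pt evaluation_def)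
qed

lemma continuous_map_pt:
  assumes C: "C \<in> Obj (Cat P)"
  shows "continuous_map X (pt P C) g \<longleftrightarrow> g \<in> topspace X \<rightarrow> Hom (Cat P) C (two P) \<and>
    (\<forall>a\<in>und P C. openin X {x \<in> topspace X. iota P (act P C (two P) (g x) a) = 1})"
proof -
  have pre: "{x \<in> topspace X. g x \<in> {f \<in> Hom (Cat P) C (two P). iota P (act P C (two P) f a) = 1}} =
    {x \<in> topspace X. iota P (act P C (two P) (g x) a) = 1}"
    if "g \<in> topspace X \<rightarrow> Hom (Cat P) C (two P)" for a using that by auto
  have *: "(\<forall>U. (\<exists>a\<in>A. U = D a) \<longrightarrow> Q U) \<longleftrightarrow> (\<forall>a\<in>A. Q (D a))"
    for A :: "'u set" and D :: "'u \<Rightarrow> 'u set" and Q by blast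
  have "(\<forall>U. openin (pt P C) U \<longrightarrow> openin X {x \<in> topspace X. g x \<in> U}) \<longleftrightarrow>
    (\<forall>a\<in>und P C. openin X {x \<in> topspace X.
       g x \<in> {f \<in> Hom (Cat P) C (two P). iota P (act P C (two P) f a) = 1}})"
    unfolding openin_pt[OF C] by (rule *)
  then show ?thesis
    unfolding continuous_map_def topspace_pt[OF C] using pre by (simp cong: conj_cong)
qed

end

context pfc
begin

section \<open>Cartesian lifts of evaluation maps\<close>

text \<open>The data carried by a cartesian lift \<open>(E, \<theta>)\<close> of the evaluations at the points of \<open>X\<close>.\<close>

lemma Omega_liftD:
  assumes "Omega_lift P X E \<theta>"
  shows "E \<in> Obj (Cat P)" and "bij_betw \<theta> (und P E) (Hom Top X Sierpinski)"
    and "x \<in> topspace X \<Longrightarrow> lifts P E (two P) (iota_inv P \<circ> chi x \<circ> \<theta>)"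
    and "D \<in> Obj (Cat P) \<Longrightarrow> h \<in> und P D \<rightarrow> und P E \<Longrightarrow>
      (\<And>x. x \<in> topspace X \<Longrightarrow> lifts P D (two P) (iota_inv P \<circ> chi x \<circ> \<theta> \<circ> h)) \<Longrightarrow> lifts P D E h"
proof -
  show E: "E \<in> Obj (Cat P)" and "bij_betw \<theta> (und P E) (Hom Top X Sierpinski)"
    and "D \<in> Obj (Cat P) \<Longrightarrow> h \<in> und P D \<rightarrow> und P E \<Longrightarrow>
      (\<And>x. x \<in> topspace X \<Longrightarrow> lifts P D (two P) (iota_inv P \<circ> chi x \<circ> \<theta> \<circ> h)) \<Longrightarrow> lifts P D E h"
    using assms unfolding Omega_lift_def cartesian_lift_def by blast+
  have "lifts P E E (\<lambda>a. a)"
    using E by (intro lifts_act[OF Idt_Hom]) (auto simp: act_Idt)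
  moreover have "(\<lambda>a. a) \<in> und P E \<rightarrow> und P E" by simp
  ultimately have "\<forall>x\<in>topspace X. lifts P E (two P) (iota_inv P \<circ> chi x \<circ> \<theta> \<circ> (\<lambda>a. a))"
    using E assms unfolding Omega_lift_def cartesian_lift_def by blast
  then show "x \<in> topspace X \<Longrightarrow> lifts P E (two P) (iota_inv P \<circ> chi x \<circ> \<theta>)"
    by (simp add: comp_def)
qed

lemma Omega_lift_in:
  assumes "Omega_lift P X E \<theta>" "a \<in> und P E" shows "\<theta> a \<in> Hom Top X Sierpinski"
  using Omega_liftD(2)[OF assms(1)] assms(2) by (auto simp: bij_betw_def)

text \<open>The comparison between two cartesian lifts of the same family.\<close>

lemma Omega_lift_compare:
  assumes E: "Omega_lift P X E \<theta>" and F: "Omega_lift P X F \<theta>'"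
  shows "lifts P E F (\<lambda>a. inv_into (und P F) \<theta>' (\<theta> a))"
proof (rule Omega_liftD(4)[OF F Omega_liftD(1)[OF E]])
  have r: "\<theta>' (inv_into (und P F) \<theta>' (\<theta> a)) = \<theta> a" if "a \<in> und P E" for a
    using Omega_lift_in[OF E that] Omega_liftD(2)[OF F] by (simp add: bij_betw_inv_into_right)
  show "(\<lambda>a. inv_into (und P F) \<theta>' (\<theta> a)) \<in> und P E \<rightarrow> und P F"
  proof
    fix a assume "a \<in> und P E"
    then have "\<theta> a \<in> \<theta>' ` und P F"
      using Omega_lift_in[OF E] Omega_liftD(2)[OF F] by (simp add: bij_betw_def)
    then show "inv_into (und P F) \<theta>' (\<theta> a) \<in> und P F" by (rule inv_into_into)
  qed
  show "lifts P E (two P) (iota_inv P \<circ> chi x \<circ> \<theta>' \<circ> (\<lambda>a. inv_into (und P F) \<theta>' (\<theta> a)))"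
    if "x \<in> topspace X" for x
    using Omega_liftD(3)[OF E that] r by (subst lifts_cong[where k = "iota_inv P \<circ> chi x \<circ> \<theta>"]) auto
qed

lemma Omega_lift_iso:
  assumes E: "Omega_lift P X E \<theta>" and F: "Omega_lift P X F \<theta>'"
  shows "iso_arr (Cat P) E F (lift_of P E F (\<lambda>a. inv_into (und P F) \<theta>' (\<theta> a)))"
proof -
  have aux: "\<exists>p. p \<in> Hom (Cat P) E F \<and> p = lift_of P E F (\<lambda>a. inv_into (und P F) \<theta>' (\<theta> a)) \<and>
      (\<forall>a\<in>und P E. \<theta>' (act P E F p a) = \<theta> a)"
    if E: "Omega_lift P X E \<theta>" and F: "Omega_lift P X F \<theta>'" for E F \<theta> \<theta>'
  proof -
    note l = is_lift_lift_of[OF Omega_liftD(1)[OF E] Omega_liftD(1)[OF F] Omega_lift_compare[OF E F]]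
    show ?thesis
      using l Omega_lift_in[OF E] Omega_liftD(2)[OF F] by (simp add: bij_betw_inv_into_right)
  qed
  obtain p where p: "p \<in> Hom (Cat P) E F" "p = lift_of P E F (\<lambda>a. inv_into (und P F) \<theta>' (\<theta> a))"
    "\<And>a. a\<in>und P E \<Longrightarrow> \<theta>' (act P E F p a) = \<theta> a" using aux[OF E F] by blast
  obtain q where q: "q \<in> Hom (Cat P) F E" "\<And>a. a\<in>und P F \<Longrightarrow> \<theta> (act P F E q a) = \<theta>' a"
    using aux[OF F E] by blast
  note EF = Omega_liftD(1)[OF E] Omega_liftD(1)[OF F]
  have "Cmp (Cat P) A B A g f = Idt (Cat P) A"
    if A: "A \<in> Obj (Cat P)" and B: "B \<in> Obj (Cat P)" and f: "f \<in> Hom (Cat P) A B"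
      "\<And>a. a\<in>und P A \<Longrightarrow> \<theta>B (act P A B f a) = \<theta>A a"
      and g: "g \<in> Hom (Cat P) B A" "\<And>a. a\<in>und P B \<Longrightarrow> \<theta>A (act P B A g a) = \<theta>B a"
      and inj: "inj_on \<theta>A (und P A)" for A B f g \<theta>A and \<theta>B :: "'u \<Rightarrow> 'u \<Rightarrow> 'u"
  proof (rule arr_eqI[OF A A])
    fix a assume a: "a \<in> und P A"
    have fa: "act P A B f a \<in> und P B" using act_in[OF A B f(1) a] .
    then have "act P B A g (act P A B f a) = a"
      using inj a act_in[OF B A g(1)] f g by (auto simp: inj_on_def)
    then show "act P A A (Cmp (Cat P) A B A g f) a = act P A A (Idt (Cat P) A) a"
      using A B f(1) g(1) a by (simp add: act_Cmp act_Idt)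
  qed (use A B f g in \<open>auto intro: Cmp_Hom Idt_Hom\<close>)
  note * = this
  have "inj_on \<theta> (und P E)" "inj_on \<theta>' (und P F)"
    using Omega_liftD(2)[OF E] Omega_liftD(2)[OF F] by (auto simp: bij_betw_def)
  then have "Cmp (Cat P) E F E q p = Idt (Cat P) E" "Cmp (Cat P) F E F p q = Idt (Cat P) F"
    using *[of E F p \<theta>' \<theta> q, OF EF p(1,3) q] *[of F E q \<theta> \<theta>' p, OF EF(2,1) q p(1,3)] by simp_all
  then show ?thesis
    using p(1) q(1) unfolding iso_arr_def p(2)[symmetric] by blast
qed

lemma Omega_Obj: "X \<in> Obj (TopC P) \<Longrightarrow> Omega P X \<in> Obj (Cat P)"
  using Omega_liftD(1) Omega_lift_in_TopC by blast

lemma theta_in: "X \<in> Obj (TopC P) \<Longrightarrow> a \<in> und P (Omega P X) \<Longrightarrow> theta P X a \<in> Hom Top X Sierpinski"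
  using Omega_lift_in Omega_lift_in_TopC by blast

lemma theta_value:
  assumes "X \<in> Obj (TopC P)" "a \<in> und P (Omega P X)" "x \<in> topspace X"
  shows "theta P X a x = 0 \<or> theta P X a x = 1"
  using theta_in[OF assms(1,2)] assms(3) by (auto simp: continuous_map_Sierpinski)

lemma theta_bij: "X \<in> Obj (TopC P) \<Longrightarrow> bij_betw (theta P X) (und P (Omega P X)) (Hom Top X Sierpinski)"
  using Omega_liftD(2) Omega_lift_in_TopC by blast

lemma theta_theta_inv:
  "X \<in> Obj (TopC P) \<Longrightarrow> g \<in> Hom Top X Sierpinski \<Longrightarrow> theta P X (theta_inv P X g) = g"
  unfolding theta_inv_def using theta_bij bij_betw_inv_into_right by metis

lemma theta_inv_in:
  "X \<in> Obj (TopC P) \<Longrightarrow> g \<in> Hom Top X Sierpinski \<Longrightarrow> theta_inv P X g \<in> und P (Omega P X)"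
  unfolding theta_inv_def using theta_bij by (metis bij_betw_imp_surj_on inv_into_into)

text \<open>Arrows into \<open>\<Omega>X\<close> are determined, and can be constructed, after composition with \<open>\<theta>\<close>.\<close>

lemma Omega_arr_eqI:
  assumes X: "X \<in> Obj (TopC P)" and D: "D \<in> Obj (Cat P)"
    and p: "p \<in> Hom (Cat P) D (Omega P X)" and q: "q \<in> Hom (Cat P) D (Omega P X)"
    and eq: "\<And>a. a \<in> und P D \<Longrightarrow> theta P X (act P D (Omega P X) p a) = theta P X (act P D (Omega P X) q a)"
  shows "p = q"
proof (rule arr_eqI[OF D Omega_Obj[OF X] p q])
  fix a assume a: "a \<in> und P D"
  show "act P D (Omega P X) p a = act P D (Omega P X) q a"
    using eq[OF a] theta_bij[OF X] act_in[OF D Omega_Obj[OF X] p a] act_in[OF D Omega_Obj[OF X] q a]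
    by (auto simp: bij_betw_def inj_on_def)
qed

lemma Omega_arr_lift:
  assumes X: "X \<in> Obj (TopC P)" and D: "D \<in> Obj (Cat P)"
    and k: "\<And>a. a \<in> und P D \<Longrightarrow> k a \<in> Hom Top X Sierpinski"
    and l: "\<And>x. x \<in> topspace X \<Longrightarrow> lifts P D (two P) (\<lambda>a. iota_inv P (k a x))"
  shows "lift_of P D (Omega P X) (\<lambda>a. theta_inv P X (k a)) \<in> Hom (Cat P) D (Omega P X)"
    and "\<And>a. a \<in> und P D \<Longrightarrow>
      theta P X (act P D (Omega P X) (lift_of P D (Omega P X) (\<lambda>a. theta_inv P X (k a))) a) = k a"
proof -
  have "lifts P D (Omega P X) (\<lambda>a. theta_inv P X (k a))"
  proof (rule Omega_liftD(4)[OF Omega_lift_in_TopC[OF X] D])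
    show "(\<lambda>a. theta_inv P X (k a)) \<in> und P D \<rightarrow> und P (Omega P X)"
      using k theta_inv_in[OF X] by blast
    show "lifts P D (two P) (iota_inv P \<circ> chi x \<circ> theta P X \<circ> (\<lambda>a. theta_inv P X (k a)))"
      if "x \<in> topspace X" for x
      using l[OF that] theta_theta_inv[OF X k]
      by (subst lifts_cong[where k = "\<lambda>a. iota_inv P (k a x)"]) (auto simp: chi_def)
  qed
  note * = is_lift_lift_of[OF D Omega_Obj[OF X] this]
  show "lift_of P D (Omega P X) (\<lambda>a. theta_inv P X (k a)) \<in> Hom (Cat P) D (Omega P X)"
    using *(1) .
  show "theta P X (act P D (Omega P X) (lift_of P D (Omega P X) (\<lambda>a. theta_inv P X (k a))) a) = k a"
    if "a \<in> und P D" for a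
    using *(2)[OF that] theta_theta_inv[OF X k[OF that]] by simp
qed

lemma chi_bar:
  assumes X: "X \<in> Obj (TopC P)" and x: "x \<in> topspace X"
  shows "chi_bar P X x \<in> Hom (Cat P) (Omega P X) (two P)"
    and "\<And>a. a \<in> und P (Omega P X) \<Longrightarrow> act P (Omega P X) (two P) (chi_bar P X x) a = iota_inv P (theta P X a x)"
  using is_lift_lift_of[OF Omega_Obj[OF X] two_Obj Omega_liftD(3)[OF Omega_lift_in_TopC[OF X] x]]
  unfolding chi_bar_def by (auto simp: chi_def)

lemma Omega_arr:
  assumes X: "X \<in> Obj (TopC P)" and Y: "Y \<in> Obj (TopC P)" and f: "f \<in> Hom Top Y X"
  shows "farr (Omega_functor P) X Y f \<in> Hom (Cat P) (Omega P X) (Omega P Y)"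
    and "\<And>a. a \<in> und P (Omega P X) \<Longrightarrow>
      theta P Y (act P (Omega P X) (Omega P Y) (farr (Omega_functor P) X Y f) a) =
      compose (topspace Y) (theta P X a) f"
proof -
  have 1: "compose (topspace Y) (theta P X a) f \<in> Hom Top Y Sierpinski" if "a \<in> und P (Omega P X)" for a
    using Top_Cmp_closed[OF f theta_in[OF X that]] .
  have 2: "lifts P (Omega P X) (two P) (\<lambda>a. iota_inv P (compose (topspace Y) (theta P X a) f y))"
    if "y \<in> topspace Y" for y
    using chi_bar[OF X Top_arr_in[OF f that]] that
    by (intro lifts_act[of "chi_bar P X (f y)"]) (auto simp: compose_def)
  show "farr (Omega_functor P) X Y f \<in> Hom (Cat P) (Omega P X) (Omega P Y)"
    and "\<And>a. a \<in> und P (Omega P X) \<Longrightarrow>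
      theta P Y (act P (Omega P X) (Omega P Y) (farr (Omega_functor P) X Y f) a) =
      compose (topspace Y) (theta P X a) f"
    using Omega_arr_lift[OF Y Omega_Obj[OF X] 1 2] by (simp_all add: Omega_functor_def)
qed

lemma eta:
  assumes C: "C \<in> Obj (Cat P)" and T: "pt P C \<in> Obj (TopC P)"
  shows "eta P C \<in> Hom (Cat P) C (Omega P (pt P C))"
    and "\<And>a. a \<in> und P C \<Longrightarrow> theta P (pt P C) (act P C (Omega P (pt P C)) (eta P C) a) = evaluation P C a"
proof -
  have 2: "lifts P C (two P) (\<lambda>a. iota_inv P (evaluation P C a f))" if "f \<in> topspace (pt P C)" for f
    using that act_in[OF C two_Obj]
    by (intro lifts_act[of f]) (auto simp: topspace_pt[OF C] evaluation_def iota_inv_iota)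
  show "eta P C \<in> Hom (Cat P) C (Omega P (pt P C))"
    and "\<And>a. a \<in> und P C \<Longrightarrow> theta P (pt P C) (act P C (Omega P (pt P C)) (eta P C) a) = evaluation P C a"
    using Omega_arr_lift[OF T C evaluation_Hom[OF C] 2]
    by (simp_all only: eta_def evaluation_def)
qed

end

section \<open>The dual adjunction\<close>

text \<open>From here on, membership in hom-sets of spaces is kept folded.\<close>

declare Top_simps(2) [simp del]

lemma TopC_simps [simp]: "Hom (TopC P) = Hom Top" "Cmp (TopC P) = Cmp Top" "Idt (TopC P) = Idt Top"
  by (simp_all add: TopC_def)

lemma TopC_Top: "X \<in> Obj (TopC P) \<Longrightarrow> X \<in> Obj Top"
  by (simp add: TopC_def)

lemma category_TopC: "category (TopC P)"
  unfolding TopC_def by (intro category_full_sub category_Top)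

lemma is_functorI:
  assumes "category K" "category L"
    and "\<And>A. A \<in> Obj K \<Longrightarrow> fobj F A \<in> Obj L"
    and "\<And>A B f. A \<in> Obj K \<Longrightarrow> B \<in> Obj K \<Longrightarrow> f \<in> Hom K A B \<Longrightarrow>
      farr F A B f \<in> Hom L (fobj F A) (fobj F B)"
    and "\<And>A. A \<in> Obj K \<Longrightarrow> farr F A A (Idt K A) = Idt L (fobj F A)"
    and "\<And>A B C f g. A \<in> Obj K \<Longrightarrow> B \<in> Obj K \<Longrightarrow> C \<in> Obj K \<Longrightarrow> f \<in> Hom K A B \<Longrightarrow> g \<in> Hom K B C \<Longrightarrow>
      farr F A C (Cmp K A B C g f) =
        Cmp L (fobj F A) (fobj F B) (fobj F C) (farr F B C g) (farr F A B f)"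
  shows "is_functor K L F"
  unfolding is_functor_def by (intro conjI ballI assms)

lemma nat_transI:
  assumes "is_functor K L F" "is_functor K L G"
    and "\<And>A. A \<in> Obj K \<Longrightarrow> t A \<in> Hom L (fobj F A) (fobj G A)"
    and "\<And>A B f. A \<in> Obj K \<Longrightarrow> B \<in> Obj K \<Longrightarrow> f \<in> Hom K A B \<Longrightarrow>
       Cmp L (fobj F A) (fobj F B) (fobj G B) (t B) (farr F A B f) =
       Cmp L (fobj F A) (fobj G A) (fobj G B) (farr G A B f) (t A)"
  shows "nat_trans K L F G t"
  unfolding nat_trans_def by (intro conjI ballI assms)

text \<open>SFC-categories, and the dual adjunction that each of them carries.\<close>

locale sfc =
  fixes P :: "('o, 'u::universe) pfc"
  assumes sfc: "sfc_category P"

sublocale sfc \<subseteq> pfc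
  using sfc by unfold_locales (simp add: sfc_category_def)

context sfc
begin

lemma pt_TopC: "C \<in> Obj (Cat P) \<Longrightarrow> pt P C \<in> Obj (TopC P)"
  using sfc by (simp add: sfc_category_def)

lemma pt_functor_simps [simp]: "fobj (pt_functor P) = pt P"
  and farr_pt_functor: "g \<in> Hom (Cat P) D (two P) \<Longrightarrow>
    farr (pt_functor P) C D p g = Cmp (Cat P) C D (two P) g p"
  by (simp_all add: pt_functor_def)

lemma Omega_functor_simps [simp]: "fobj (Omega_functor P) = Omega P"
  by (simp add: Omega_functor_def)

lemma pt_arr:
  assumes C: "C \<in> Obj (Cat P)" and D: "D \<in> Obj (Cat P)" and p: "p \<in> Hom (Cat P) C D"
  shows "farr (pt_functor P) C D p \<in> Hom Top (pt P D) (pt P C)"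
proof -
  let ?F = "farr (pt_functor P) C D p"
  have "?F \<in> topspace (pt P D) \<rightarrow> Hom (Cat P) C (two P)"
    by (auto simp: topspace_pt[OF D] farr_pt_functor intro: Cmp_Hom[OF C D two_Obj p])
  moreover have "openin (pt P D) {g \<in> topspace (pt P D). iota P (act P C (two P) (?F g) a) = 1}"
    if a: "a \<in> und P C" for a
  proof -
    have "{g \<in> topspace (pt P D). iota P (act P C (two P) (?F g) a) = 1} =
        {g \<in> Hom (Cat P) D (two P). iota P (act P D (two P) g (act P C D p a)) = 1}"
      unfolding topspace_pt[OF D]
      by (rule Collect_cong) (auto simp: farr_pt_functor act_Cmp[OF C D two_Obj p _ a])
    then show ?thesis
      unfolding openin_pt[OF D] using act_in[OF C D p a] by blast
  qed
  moreover have "?F \<in> extensional (topspace (pt P D))"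
    by (simp add: pt_functor_def topspace_pt[OF D])
  ultimately show ?thesis
    by (simp add: Top_simps(2) continuous_map_pt[OF C])
qed

lemma is_functor_pt: "is_functor (Cat P) (op_cat (TopC P)) (pt_functor P)"
proof (rule is_functorI)
  show "category (op_cat (TopC P))" by (intro category_op_cat category_TopC)
  show "fobj (pt_functor P) C \<in> Obj (op_cat (TopC P))" if "C \<in> Obj (Cat P)" for C
    using that pt_TopC by simp
  show "farr (pt_functor P) C D p \<in> Hom (op_cat (TopC P)) (fobj (pt_functor P) C) (fobj (pt_functor P) D)"
    if "C \<in> Obj (Cat P)" "D \<in> Obj (Cat P)" "p \<in> Hom (Cat P) C D" for C D p
    using pt_arr[OF that] by simp
  show "farr (pt_functor P) C C (Idt (Cat P) C) = Idt (op_cat (TopC P)) (fobj (pt_functor P) C)"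
    if C: "C \<in> Obj (Cat P)" for C
    using category_Cat C two_Obj
    by (auto simp: pt_functor_def topspace_pt[OF C] category_def fun_eq_iff)
  show "farr (pt_functor P) A C (Cmp (Cat P) A B C g f) =
    Cmp (op_cat (TopC P)) (fobj (pt_functor P) A) (fobj (pt_functor P) B) (fobj (pt_functor P) C)
      (farr (pt_functor P) B C g) (farr (pt_functor P) A B f)"
    if A: "A \<in> Obj (Cat P)" and B: "B \<in> Obj (Cat P)" and C: "C \<in> Obj (Cat P)"
      and f: "f \<in> Hom (Cat P) A B" and g: "g \<in> Hom (Cat P) B C" for A B C f g
  proof -
    have "Cmp (Cat P) A C (two P) h (Cmp (Cat P) A B C g f) =
        Cmp (Cat P) A B (two P) (Cmp (Cat P) B C (two P) h g) f"
      if "h \<in> Hom (Cat P) C (two P)" for h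
      using category_Cat A B C f g two_Obj that unfolding category_def by auto
    then show ?thesis
      using Cmp_Hom[OF B C two_Obj g]
      by (auto simp: pt_functor_def topspace_pt[OF C] compose_def fun_eq_iff)
  qed
qed (rule category_Cat)

lemma is_functor_Omega: "is_functor (op_cat (TopC P)) (Cat P) (Omega_functor P)"
proof (rule is_functorI)
  show "category (op_cat (TopC P))" by (intro category_op_cat category_TopC)
  show "fobj (Omega_functor P) X \<in> Obj (Cat P)" if "X \<in> Obj (op_cat (TopC P))" for X
    using that Omega_Obj by simp
  show "farr (Omega_functor P) X Y f \<in> Hom (Cat P) (fobj (Omega_functor P) X) (fobj (Omega_functor P) Y)"
    if "X \<in> Obj (op_cat (TopC P))" "Y \<in> Obj (op_cat (TopC P))" "f \<in> Hom (op_cat (TopC P)) X Y" for X Y f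
    using that Omega_arr(1)[of X Y f] by simp
  show "farr (Omega_functor P) X X (Idt (op_cat (TopC P)) X) = Idt (Cat P) (fobj (Omega_functor P) X)"
    if "X \<in> Obj (op_cat (TopC P))" for X
  proof -
    have X: "X \<in> Obj (TopC P)" using that by simp
    have id: "Idt Top X \<in> Hom Top X X"
      using category_Top TopC_Top[OF X] unfolding category_def by blast
    have "farr (Omega_functor P) X X (Idt Top X) = Idt (Cat P) (Omega P X)"
    proof (rule Omega_arr_eqI[OF X Omega_Obj[OF X] Omega_arr(1)[OF X X id] Idt_Hom[OF Omega_Obj[OF X]]])
      fix a assume a: "a \<in> und P (Omega P X)"
      have "compose (topspace X) (theta P X a) (Idt Top X) = theta P X a"
        using theta_in[OF X a] by (auto simp: Top_simps(2) compose_def extensional_def fun_eq_iff)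
      then show "theta P X (act P (Omega P X) (Omega P X) (farr (Omega_functor P) X X (Idt Top X)) a) =
          theta P X (act P (Omega P X) (Omega P X) (Idt (Cat P) (Omega P X)) a)"
        unfolding Omega_arr(2)[OF X X id a] act_Idt[OF Omega_Obj[OF X] a] .
    qed
    then show ?thesis by simp
  qed
  show "farr (Omega_functor P) X Z (Cmp (op_cat (TopC P)) X Y Z g f) =
    Cmp (Cat P) (fobj (Omega_functor P) X) (fobj (Omega_functor P) Y) (fobj (Omega_functor P) Z)
      (farr (Omega_functor P) Y Z g) (farr (Omega_functor P) X Y f)"
    if "X \<in> Obj (op_cat (TopC P))" "Y \<in> Obj (op_cat (TopC P))" "Z \<in> Obj (op_cat (TopC P))"
      "f \<in> Hom (op_cat (TopC P)) X Y" "g \<in> Hom (op_cat (TopC P)) Y Z" for X Y Z f g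
  proof -
    have X: "X \<in> Obj (TopC P)" and Y: "Y \<in> Obj (TopC P)" and Z: "Z \<in> Obj (TopC P)"
      and f: "f \<in> Hom Top Y X" and g: "g \<in> Hom Top Z Y" using that by simp_all
    have fg: "compose (topspace Z) f g \<in> Hom Top Z X" using Top_Cmp_closed[OF g f] .
    note \<Omega> = Omega_Obj[OF X] Omega_Obj[OF Y] Omega_Obj[OF Z]
    note Of = Omega_arr[OF X Y f] and Og = Omega_arr[OF Y Z g]
    have "farr (Omega_functor P) X Z (compose (topspace Z) f g) =
      Cmp (Cat P) (Omega P X) (Omega P Y) (Omega P Z) (farr (Omega_functor P) Y Z g) (farr (Omega_functor P) X Y f)"
    proof (rule Omega_arr_eqI[OF Z \<Omega>(1) Omega_arr(1)[OF X Z fg] Cmp_Hom[OF \<Omega> Of(1) Og(1)]])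
      fix a assume a: "a \<in> und P (Omega P X)"
      have "compose (topspace Z) (theta P X a) (compose (topspace Z) f g) =
          compose (topspace Z) (compose (topspace Y) (theta P X a) f) g"
        using Top_arr_in[OF g] by (auto simp: compose_def fun_eq_iff)
      then show "theta P Z (act P (Omega P X) (Omega P Z) (farr (Omega_functor P) X Z (compose (topspace Z) f g)) a) =
        theta P Z (act P (Omega P X) (Omega P Z) (Cmp (Cat P) (Omega P X) (Omega P Y) (Omega P Z)
          (farr (Omega_functor P) Y Z g) (farr (Omega_functor P) X Y f)) a)"
        unfolding Omega_arr(2)[OF X Z fg a] act_Cmp[OF \<Omega> Of(1) Og(1) a]
          Og(2)[OF act_in[OF \<Omega>(1,2) Of(1) a]] Of(2)[OF a] .
    qed
    then show ?thesis by simp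
  qed
qed (rule category_Cat)

lemma sigma_apply: "x \<in> topspace X \<Longrightarrow> sigma P X x = chi_bar P X x"
  by (simp add: sigma_def)

lemma sigma_Hom:
  assumes X: "X \<in> Obj (TopC P)"
  shows "sigma P X \<in> Hom Top X (pt P (Omega P X))"
proof -
  note \<Omega> = Omega_Obj[OF X]
  have "sigma P X \<in> topspace X \<rightarrow> Hom (Cat P) (Omega P X) (two P)"
    using chi_bar(1)[OF X] by (simp add: sigma_apply)
  moreover have "openin X {x \<in> topspace X. iota P (act P (Omega P X) (two P) (sigma P X x) a) = 1}"
    if a: "a \<in> und P (Omega P X)" for a
  proof -
    have "{x \<in> topspace X. iota P (act P (Omega P X) (two P) (sigma P X x) a) = 1} =
        {x \<in> topspace X. theta P X a x = 1}"
      using theta_value[OF X a]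
      by (intro Collect_cong) (auto simp: sigma_apply chi_bar(2)[OF X _ a] iota_iota_inv)
    then show ?thesis
      using theta_in[OF X a] by (simp add: Top_simps(2) continuous_map_Sierpinski)
  qed
  ultimately show ?thesis
    by (simp add: Top_simps(2) continuous_map_pt[OF \<Omega>] sigma_def)
qed

lemma act_sigma:
  assumes "X \<in> Obj (TopC P)" "x \<in> topspace X" "a \<in> und P (Omega P X)"
  shows "act P (Omega P X) (two P) (sigma P X x) a = iota_inv P (theta P X a x)"
  using assms by (simp add: sigma_apply chi_bar(2))

lemma sigma_in:
  assumes "X \<in> Obj (TopC P)" "x \<in> topspace X"
  shows "sigma P X x \<in> Hom (Cat P) (Omega P X) (two P)"
  using assms by (simp add: sigma_apply chi_bar(1))

lemma evaluation_apply:
  "f \<in> Hom (Cat P) C (two P) \<Longrightarrow> evaluation P C a f = iota P (act P C (two P) f a)"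
  by (simp add: evaluation_def)

lemma nat_trans_eta: "nat_trans (Cat P) (Cat P) incl (fcomp (Omega_functor P) (pt_functor P)) (eta P)"
proof (rule nat_transI)
  show "is_functor (Cat P) (Cat P) incl" by (rule is_functor_incl) (simp_all add: category_Cat)
  show "is_functor (Cat P) (Cat P) (fcomp (Omega_functor P) (pt_functor P))"
    by (rule is_functor_fcomp[OF is_functor_pt is_functor_Omega])
  show "eta P C \<in> Hom (Cat P) (fobj incl C) (fobj (fcomp (Omega_functor P) (pt_functor P)) C)"
    if "C \<in> Obj (Cat P)" for C
    using eta(1)[OF that pt_TopC[OF that]] by simp
  show "Cmp (Cat P) (fobj incl C) (fobj incl D) (fobj (fcomp (Omega_functor P) (pt_functor P)) D)
      (eta P D) (farr incl C D p) =
    Cmp (Cat P) (fobj incl C) (fobj (fcomp (Omega_functor P) (pt_functor P)) C)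
      (fobj (fcomp (Omega_functor P) (pt_functor P)) D)
      (farr (fcomp (Omega_functor P) (pt_functor P)) C D p) (eta P C)"
    if C: "C \<in> Obj (Cat P)" and D: "D \<in> Obj (Cat P)" and p: "p \<in> Hom (Cat P) C D" for C D p
  proof -
    note TC = pt_TopC[OF C] and TD = pt_TopC[OF D]
    note OC = Omega_Obj[OF TC] and OD = Omega_Obj[OF TD]
    note Op = Omega_arr[OF TC TD pt_arr[OF C D p]]
    have "Cmp (Cat P) C D (Omega P (pt P D)) (eta P D) p =
      Cmp (Cat P) C (Omega P (pt P C)) (Omega P (pt P D))
        (farr (Omega_functor P) (pt P C) (pt P D) (farr (pt_functor P) C D p)) (eta P C)"
    proof (rule Omega_arr_eqI[OF TD C Cmp_Hom[OF C D OD p eta(1)[OF D TD]] Cmp_Hom[OF C OC OD eta(1)[OF C TC] Op(1)]])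
      fix a assume a: "a \<in> und P C"
      have "evaluation P D (act P C D p a) =
        compose (topspace (pt P D)) (evaluation P C a) (farr (pt_functor P) C D p)"
        using Cmp_Hom[OF C D two_Obj p]
        by (auto simp: fun_eq_iff compose_def evaluation_def topspace_pt[OF D] farr_pt_functor
            act_Cmp[OF C D two_Obj p _ a])
      then show "theta P (pt P D) (act P C (Omega P (pt P D)) (Cmp (Cat P) C D (Omega P (pt P D)) (eta P D) p) a) =
        theta P (pt P D) (act P C (Omega P (pt P D)) (Cmp (Cat P) C (Omega P (pt P C)) (Omega P (pt P D))
          (farr (Omega_functor P) (pt P C) (pt P D) (farr (pt_functor P) C D p)) (eta P C)) a)"
        unfolding act_Cmp[OF C D OD p eta(1)[OF D TD] a] act_Cmp[OF C OC OD eta(1)[OF C TC] Op(1) a]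
          eta(2)[OF D TD act_in[OF C D p a]] Op(2)[OF act_in[OF C OC eta(1)[OF C TC] a]] eta(2)[OF C TC a] .
    qed
    then show ?thesis by simp
  qed
qed

lemma nat_trans_sigma:
  "nat_trans (op_cat (TopC P)) (op_cat (TopC P)) (fcomp (pt_functor P) (Omega_functor P)) incl (sigma P)"
proof (rule nat_transI)
  show "is_functor (op_cat (TopC P)) (op_cat (TopC P)) incl"
    by (rule is_functor_incl) (simp_all add: category_TopC category_op_cat)
  show "is_functor (op_cat (TopC P)) (op_cat (TopC P)) (fcomp (pt_functor P) (Omega_functor P))"
    by (rule is_functor_fcomp[OF is_functor_Omega is_functor_pt])
  show "sigma P X \<in> Hom (op_cat (TopC P)) (fobj (fcomp (pt_functor P) (Omega_functor P)) X) (fobj incl X)"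
    if "X \<in> Obj (op_cat (TopC P))" for X
    using that sigma_Hom by simp
  show "Cmp (op_cat (TopC P)) (fobj (fcomp (pt_functor P) (Omega_functor P)) X)
      (fobj (fcomp (pt_functor P) (Omega_functor P)) Y) (fobj incl Y) (sigma P Y)
      (farr (fcomp (pt_functor P) (Omega_functor P)) X Y f) =
    Cmp (op_cat (TopC P)) (fobj (fcomp (pt_functor P) (Omega_functor P)) X) (fobj incl X) (fobj incl Y)
      (farr incl X Y f) (sigma P X)"
    if "X \<in> Obj (op_cat (TopC P))" "Y \<in> Obj (op_cat (TopC P))" "f \<in> Hom (op_cat (TopC P)) X Y" for X Y f
  proof -
    have X: "X \<in> Obj (TopC P)" and Y: "Y \<in> Obj (TopC P)" and f: "f \<in> Hom Top Y X"
      using that by simp_all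
    note OX = Omega_Obj[OF X] and OY = Omega_Obj[OF Y] and Of = Omega_arr[OF X Y f]
    have "farr (pt_functor P) (Omega P X) (Omega P Y) (farr (Omega_functor P) X Y f) (sigma P Y y) =
      sigma P X (f y)" if y: "y \<in> topspace Y" for y
    proof -
      note sy = sigma_in[OF Y y] and fy = Top_arr_in[OF f y]
      show ?thesis
        unfolding farr_pt_functor[OF sy]
      proof (rule arr_eqI[OF OX two_Obj Cmp_Hom[OF OX OY two_Obj Of(1) sy] sigma_in[OF X fy]])
        fix a assume a: "a \<in> und P (Omega P X)"
        show "act P (Omega P X) (two P) (Cmp (Cat P) (Omega P X) (Omega P Y) (two P) (sigma P Y y)
            (farr (Omega_functor P) X Y f)) a = act P (Omega P X) (two P) (sigma P X (f y)) a"
          unfolding act_Cmp[OF OX OY two_Obj Of(1) sy a] act_sigma[OF Y y act_in[OF OX OY Of(1) a]]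
            act_sigma[OF X fy a] Of(2)[OF a] using y by (simp add: compose_def)
      qed
    qed
    then show ?thesis by (auto simp: compose_def fun_eq_iff)
  qed
qed

text \<open>
  Both triangle identities reduce to \<open>\<iota>\<inverse>\<iota> = id\<close> and \<open>\<iota>\<iota>\<inverse> = id\<close>: on \<open>pt(C)\<close> the composite sends \<open>f\<close> to
  the arrow over \<open>a \<mapsto> \<iota>\<inverse>(\<iota>(O f(a)))\<close>, and on \<open>\<Omega>X\<close> the map \<open>\<theta> a\<close> is sent to \<open>x \<mapsto> \<iota>(\<iota>\<inverse>(\<theta> a x))\<close>.
\<close>

theorem adjunction_dual: "adjunction (Cat P) (op_cat (TopC P)) (dual_adj P)"
proof -
  have 1: "compose (topspace (pt P C)) (farr (pt_functor P) C (Omega P (pt P C)) (eta P C)) (sigma P (pt P C)) =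
      restrict (\<lambda>x. x) (topspace (pt P C))" if C: "C \<in> Obj (Cat P)" for C
  proof -
    note T = pt_TopC[OF C] and e = eta[OF C pt_TopC[OF C]]
    note O = Omega_Obj[OF T]
    have "farr (pt_functor P) C (Omega P (pt P C)) (eta P C) (sigma P (pt P C) f) = f"
      if "f \<in> topspace (pt P C)" for f
    proof -
      have f: "f \<in> Hom (Cat P) C (two P)" using that topspace_pt[OF C] by simp
      note sf = sigma_in[OF T that]
      show ?thesis
        unfolding farr_pt_functor[OF sf]
      proof (rule arr_eqI[OF C two_Obj Cmp_Hom[OF C O two_Obj e(1) sf] f])
        fix a assume a: "a \<in> und P C"
        show "act P C (two P) (Cmp (Cat P) C (Omega P (pt P C)) (two P) (sigma P (pt P C) f) (eta P C)) a =
            act P C (two P) f a"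
          unfolding act_Cmp[OF C O two_Obj e(1) sf a] act_sigma[OF T that act_in[OF C O e(1) a]] e(2)[OF a]
            evaluation_apply[OF f] by (rule iota_inv_iota[OF act_in[OF C two_Obj f a]])
      qed
    qed
    then show ?thesis by (auto simp: compose_def fun_eq_iff)
  qed
  have 2: "Cmp (Cat P) (Omega P X) (Omega P (pt P (Omega P X))) (Omega P X)
      (farr (Omega_functor P) (pt P (Omega P X)) X (sigma P X)) (eta P (Omega P X)) = Idt (Cat P) (Omega P X)"
    if X: "X \<in> Obj (TopC P)" for X
  proof -
    note OX = Omega_Obj[OF X] 
    note T = pt_TopC[OF OX]
    note OT = Omega_Obj[OF T] and e = eta[OF OX T] and s = Omega_arr[OF T X sigma_Hom[OF X]]
    show ?thesis
    proof (rule Omega_arr_eqI[OF X OX Cmp_Hom[OF OX OT OX e(1) s(1)] Idt_Hom[OF OX]])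
      fix a assume a: "a \<in> und P (Omega P X)"
      have "compose (topspace X) (evaluation P (Omega P X) a) (sigma P X) = theta P X a"
      proof (rule extensionalityI[where A = "topspace X"])
        show "compose (topspace X) (evaluation P (Omega P X) a) (sigma P X) x = theta P X a x"
          if x: "x \<in> topspace X" for x
          using x theta_value[OF X a x]
          by (simp add: compose_def evaluation_apply sigma_in[OF X] act_sigma[OF X x a] iota_iota_inv)
      qed (use theta_in[OF X a] in \<open>simp_all add: Top_simps(2)\<close>)
      then show "theta P X (act P (Omega P X) (Omega P X) (Cmp (Cat P) (Omega P X) (Omega P (pt P (Omega P X))) (Omega P X)
          (farr (Omega_functor P) (pt P (Omega P X)) X (sigma P X)) (eta P (Omega P X))) a) =
          theta P X (act P (Omega P X) (Omega P X) (Idt (Cat P) (Omega P X)) a)"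
        unfolding act_Cmp[OF OX OT OX e(1) s(1) a] s(2)[OF act_in[OF OX OT e(1) a]] e(2)[OF a]
          act_Idt[OF OX a] .
    qed
  qed
  show ?thesis
    unfolding adjunction_def dual_adj_def Let_def adj.simps
  proof (intro conjI ballI is_functor_pt is_functor_Omega nat_trans_eta nat_trans_sigma)
    show "Cmp (op_cat (TopC P)) (fobj (pt_functor P) C)
        (fobj (pt_functor P) (fobj (Omega_functor P) (fobj (pt_functor P) C))) (fobj (pt_functor P) C)
        (sigma P (fobj (pt_functor P) C))
        (farr (pt_functor P) C (fobj (Omega_functor P) (fobj (pt_functor P) C)) (eta P C)) =
      Idt (op_cat (TopC P)) (fobj (pt_functor P) C)" if "C \<in> Obj (Cat P)" for C
      using 1[OF that] by simp
    show "Cmp (Cat P) (fobj (Omega_functor P) X)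
        (fobj (Omega_functor P) (fobj (pt_functor P) (fobj (Omega_functor P) X))) (fobj (Omega_functor P) X)
        (farr (Omega_functor P) (fobj (pt_functor P) (fobj (Omega_functor P) X)) X (sigma P X))
        (eta P (fobj (Omega_functor P) X)) =
      Idt (Cat P) (fobj (Omega_functor P) X)" if "X \<in> Obj (op_cat (TopC P))" for X
      using 2[of X] that by simp
  qed
qed

end

section \<open>The adjunction morphism induced by an SFC-functor\<close>

lemma is_functorD:
  assumes "is_functor K L F"
  shows "A \<in> Obj K \<Longrightarrow> fobj F A \<in> Obj L"
    and "A \<in> Obj K \<Longrightarrow> B \<in> Obj K \<Longrightarrow> f \<in> Hom K A B \<Longrightarrow> farr F A B f \<in> Hom L (fobj F A) (fobj F B)"
    and "A \<in> Obj K \<Longrightarrow> B \<in> Obj K \<Longrightarrow> C \<in> Obj K \<Longrightarrow> f \<in> Hom K A B \<Longrightarrow> g \<in> Hom K B C \<Longrightarrow>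
      farr F A C (Cmp K A B C g f) =
        Cmp L (fobj F A) (fobj F B) (fobj F C) (farr F B C g) (farr F A B f)"
  using assms unfolding is_functor_def by simp_all

lemma iso_arr_Hom: "iso_arr K A B f \<Longrightarrow> f \<in> Hom K A B"
  by (simp add: iso_arr_def)

text \<open>An SFC-functor between two SFC-categories, with \<open>M\<close> the data of its induced adjunction morphism.\<close>

locale sfc_functor_between = P: sfc P + Q: sfc Q
  for P :: "('o, 'u::universe) pfc" and Q :: "('p, 'u) pfc" +
  fixes H :: "('o, 'u, 'p, 'u) fctr" and \<alpha> :: "'o \<Rightarrow> 'u \<Rightarrow> 'u" and i :: 'u
  assumes H: "sfc_functor P Q H \<alpha> i"
begin

abbreviation (input) "M \<equiv> Dual P Q H \<alpha> i"

lemma functor_H: "is_functor (Cat P) (Cat Q) H"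
  using H by (simp add: sfc_functor_def)

lemmas H_Obj = is_functorD(1)[OF functor_H]
  and H_Hom = is_functorD(2)[OF functor_H]
  and H_Cmp = is_functorD(3)[OF functor_H]

lemma H_two: "fobj H (two P) \<in> Obj (Cat Q)"
  by (rule H_Obj[OF P.two_Obj])

lemma alpha_bij:
  assumes "C \<in> Obj (Cat P)"
  shows "bij_betw (\<alpha> C) (und Q (fobj H C)) (und P C)"
  using H assms by (intro Frm_iso_arr_bij) (simp add: sfc_functor_def nat_iso_def)

lemma alpha_in: "C \<in> Obj (Cat P) \<Longrightarrow> a \<in> und Q (fobj H C) \<Longrightarrow> \<alpha> C a \<in> und P C"
  using alpha_bij by (rule bij_betwE[THEN bspec])

lemma alpha_nat:
  assumes "C \<in> Obj (Cat P)" "D \<in> Obj (Cat P)" "p \<in> Hom (Cat P) C D" and a: "a \<in> und Q (fobj H C)"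
  shows "\<alpha> D (act Q (fobj H C) (fobj H D) (farr H C D p) a) = act P C D p (\<alpha> C a)"
proof -
  have *: "compose (und Q (fobj H C)) (\<alpha> D) (act Q (fobj H C) (fobj H D) (farr H C D p)) =
      compose (und Q (fobj H C)) (act P C D p) (\<alpha> C)"
    using H assms(1-3) by (simp add: sfc_functor_def nat_iso_def nat_trans_def)
  show ?thesis using fun_cong[OF *, of a] a by (simp add: compose_def)
qed

lemma i_iso: "iso_arr (Cat Q) (fobj H (two P)) (two Q) i"
  using H by (simp add: sfc_functor_def)

lemmas i_Hom = iso_arr_Hom[OF i_iso]

lemma iota_i:
  assumes a: "a \<in> und Q (fobj H (two P))"
  shows "iota Q (act Q (fobj H (two P)) (two Q) i a) = iota P (\<alpha> (two P) a)"
proof -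
  have *: "compose (und Q (fobj H (two P))) (iota Q) (act Q (fobj H (two P)) (two Q) i) =
      compose (und Q (fobj H (two P))) (iota P) (\<alpha> (two P))"
    using H by (simp add: sfc_functor_def)
  show ?thesis using fun_cong[OF *, of a] a by (simp add: compose_def)
qed

text \<open>
  Up to the isomorphism \<open>i\<close>, the two ways of turning a two-valued function into one on the
  underlying set of the dualizing object of \<open>Q\<close> have the same lifts.
\<close>

lemma lifts_two:
  assumes D: "D \<in> Obj (Cat Q)" and g: "\<And>a. a \<in> und Q D \<Longrightarrow> g a = 0 \<or> g a = 1"
  shows "lifts Q D (fobj H (two P)) (\<lambda>a. inv_into (und Q (fobj H (two P))) (\<alpha> (two P)) (iota_inv P (g a)))
    \<longleftrightarrow> lifts Q D (two Q) (\<lambda>a. iota_inv Q (g a))" (is "lifts Q D ?T (\<lambda>a. ?k (g a)) \<longleftrightarrow> _")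
proof -
  note bij = alpha_bij[OF P.two_Obj]
  have k_in: "?k s \<in> und Q ?T" if "s = 0 \<or> s = 1" for s
    using P.iota_inv_in[OF that] bij by (metis bij_betw_imp_surj_on inv_into_into)
  have ik: "act Q ?T (two Q) i (?k s) = iota_inv Q s" if s: "s = 0 \<or> s = 1" for s
  proof -
    have "iota Q (act Q ?T (two Q) i (?k s)) = s"
      using iota_i[OF k_in[OF s]] bij P.iota_inv_in[OF s] P.iota_iota_inv[OF s]
      by (simp add: bij_betw_inv_into_right)
    then show ?thesis
      using Q.iota_inv_iota[OF Q.act_in[OF H_two Q.two_Obj i_Hom k_in[OF s]]] by simp
  qed
  obtain j where j: "j \<in> Hom (Cat Q) (two Q) ?T" "Cmp (Cat Q) ?T (two Q) ?T j i = Idt (Cat Q) ?T"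
    using i_iso by (auto simp: iso_arr_def)
  have ji: "act Q (two Q) ?T j (act Q ?T (two Q) i b) = b" if "b \<in> und Q ?T" for b
    using Q.act_Cmp[OF H_two Q.two_Obj H_two i_Hom j(1) that] Q.act_Idt[OF H_two that] j(2) by simp
  show ?thesis
  proof
    assume "lifts Q D ?T (\<lambda>a. ?k (g a))"
    then obtain p where p: "p \<in> Hom (Cat Q) D ?T" "\<And>a. a \<in> und Q D \<Longrightarrow> act Q D ?T p a = ?k (g a)"
      by (auto simp: lifts_def is_lift_def)
    show "lifts Q D (two Q) (\<lambda>a. iota_inv Q (g a))"
    proof (rule Q.lifts_act[OF Q.Cmp_Hom[OF D H_two Q.two_Obj p(1) i_Hom]])
      fix a assume a: "a \<in> und Q D"
      show "act Q D (two Q) (Cmp (Cat Q) D ?T (two Q) i p) a = iota_inv Q (g a)"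
        unfolding Q.act_Cmp[OF D H_two Q.two_Obj p(1) i_Hom a] p(2)[OF a] by (rule ik[OF g[OF a]])
    qed
  next
    assume "lifts Q D (two Q) (\<lambda>a. iota_inv Q (g a))"
    then obtain p where p: "p \<in> Hom (Cat Q) D (two Q)" "\<And>a. a \<in> und Q D \<Longrightarrow> act Q D (two Q) p a = iota_inv Q (g a)"
      by (auto simp: lifts_def is_lift_def)
    show "lifts Q D ?T (\<lambda>a. ?k (g a))"
    proof (rule Q.lifts_act[OF Q.Cmp_Hom[OF D Q.two_Obj H_two p(1) j(1)]])
      fix a assume a: "a \<in> und Q D"
      show "act Q D ?T (Cmp (Cat Q) D (two Q) ?T j p) a = ?k (g a)"
        unfolding Q.act_Cmp[OF D Q.two_Obj H_two p(1) j(1) a] p(2)[OF a] ik[OF g[OF a], symmetric]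
        by (rule ji[OF k_in[OF g[OF a]]])
    qed
  qed
qed

text \<open>The condition on cartesian lifts in an SFC-functor, stated with the dualizing object of \<open>Q\<close>.\<close>

lemma Omega_lift_H:
  assumes X: "X \<in> Obj (TopC P)"
  shows "Omega_lift Q X (fobj H (Omega P X)) (theta P X \<circ> \<alpha> (Omega P X))"
proof -
  let ?E = "fobj H (Omega P X)" and ?\<theta> = "theta P X \<circ> \<alpha> (Omega P X)" and ?T = "fobj H (two P)"
  let ?k = "\<lambda>s. inv_into (und Q ?T) (\<alpha> (two P)) (iota_inv P s)"
  have c: "cartesian_lift Q (Hom Top X Sierpinski) ?T (topspace X)
         (\<lambda>x. inv_into (und Q ?T) (\<alpha> (two P)) \<circ> iota_inv P \<circ> chi x) ?E ?\<theta>"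
    using H X by (simp add: sfc_functor_def)
  have "lifts Q D ?T (inv_into (und Q ?T) (\<alpha> (two P)) \<circ> iota_inv P \<circ> chi x \<circ> ?\<theta> \<circ> h) \<longleftrightarrow>
      lifts Q D (two Q) (iota_inv Q \<circ> chi x \<circ> ?\<theta> \<circ> h)"
    if D: "D \<in> Obj (Cat Q)" and h: "h \<in> und Q D \<rightarrow> und Q ?E" and x: "x \<in> topspace X" for D h x
  proof -
    have "?\<theta> (h a) x = 0 \<or> ?\<theta> (h a) x = 1" if "a \<in> und Q D" for a
      using P.theta_value[OF X alpha_in[OF P.Omega_Obj[OF X]] x] h that by (simp add: Pi_iff)
    then show ?thesis
      using lifts_two[OF D, of "\<lambda>a. ?\<theta> (h a) x"] by (simp add: comp_def chi_def)
  qed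
  then show ?thesis
    using c unfolding Omega_lift_def cartesian_lift_def by simp
qed

lemma TopC_subset: "X \<in> Obj (TopC P) \<Longrightarrow> X \<in> Obj (TopC Q)"
  using Omega_lift_H TopC_Top by (blast intro: TopC_I)

lemma zeta_eq:
  "zeta M X = lift_of Q (fobj H (Omega P X)) (Omega Q X)
     (\<lambda>a. theta_inv Q X (theta P X (\<alpha> (Omega P X) a)))"
  by (simp add: Dual_def)

lemma zeta_iso:
  assumes X: "X \<in> Obj (TopC P)"
  shows "iso_arr (Cat Q) (fobj H (Omega P X)) (Omega Q X) (zeta M X)"
  using Q.Omega_lift_iso[OF Omega_lift_H[OF X] Omega_lift_in_TopC[OF TopC_subset[OF X]]]
  by (simp add: zeta_eq theta_inv_def)

lemma theta_zeta:
  assumes X: "X \<in> Obj (TopC P)" and a: "a \<in> und Q (fobj H (Omega P X))"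
  shows "theta Q X (act Q (fobj H (Omega P X)) (Omega Q X) (zeta M X) a) = theta P X (\<alpha> (Omega P X) a)"
proof -
  note T = TopC_subset[OF X] and O = P.Omega_Obj[OF X]
  have "lifts Q (fobj H (Omega P X)) (Omega Q X) (\<lambda>a. theta_inv Q X (theta P X (\<alpha> (Omega P X) a)))"
    using Q.Omega_lift_compare[OF Omega_lift_H[OF X] Omega_lift_in_TopC[OF T]]
    by (simp add: theta_inv_def)
  then have "act Q (fobj H (Omega P X)) (Omega Q X) (zeta M X) a = theta_inv Q X (theta P X (\<alpha> (Omega P X) a))"
    using Q.is_lift_lift_of(2)[OF H_Obj[OF O] Q.Omega_Obj[OF T] _ a] by (simp add: zeta_eq)
  then show ?thesis
    using Q.theta_theta_inv[OF T P.theta_in[OF X alpha_in[OF O a]]] by simp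
qed

lemma xi_apply:
  assumes "f \<in> Hom (Cat P) C (two P)"
  shows "xi M C f = Cmp (Cat Q) (fobj H C) (fobj H (two P)) (two Q) i (farr H C (two P) f)"
  using assms by (simp add: Dual_def)

lemma xi_in:
  assumes C: "C \<in> Obj (Cat P)" and f: "f \<in> Hom (Cat P) C (two P)"
  shows "xi M C f \<in> Hom (Cat Q) (fobj H C) (two Q)"
  unfolding xi_apply[OF f]
  by (rule Q.Cmp_Hom[OF H_Obj[OF C] H_two Q.two_Obj H_Hom[OF C P.two_Obj f] i_Hom])

text \<open>Under \<open>\<xi>\<close> and \<open>\<alpha>\<close>, evaluation in \<open>Q\<close> becomes evaluation in \<open>P\<close>.\<close>

lemma iota_act_xi:
  assumes C: "C \<in> Obj (Cat P)" and f: "f \<in> Hom (Cat P) C (two P)" and a: "a \<in> und Q (fobj H C)"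
  shows "iota Q (act Q (fobj H C) (two Q) (xi M C f) a) = iota P (act P C (two P) f (\<alpha> C a))"
  unfolding xi_apply[OF f] Q.act_Cmp[OF H_Obj[OF C] H_two Q.two_Obj H_Hom[OF C P.two_Obj f] i_Hom a]
    iota_i[OF Q.act_in[OF H_Obj[OF C] H_two H_Hom[OF C P.two_Obj f] a]]
    alpha_nat[OF C P.two_Obj f a] ..

lemma xi_Hom:
  assumes C: "C \<in> Obj (Cat P)"
  shows "xi M C \<in> Hom Top (pt P C) (pt Q (fobj H C))"
proof -
  have "xi M C \<in> topspace (pt P C) \<rightarrow> Hom (Cat Q) (fobj H C) (two Q)"
    using xi_in[OF C] by (simp add: P.topspace_pt[OF C])
  moreover have "openin (pt P C) {f \<in> topspace (pt P C). iota Q (act Q (fobj H C) (two Q) (xi M C f) a) = 1}"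
    if a: "a \<in> und Q (fobj H C)" for a
  proof -
    have "{f \<in> topspace (pt P C). iota Q (act Q (fobj H C) (two Q) (xi M C f) a) = 1} =
        {f \<in> Hom (Cat P) C (two P). iota P (act P C (two P) f (\<alpha> C a)) = 1}"
      unfolding P.topspace_pt[OF C] by (rule Collect_cong) (auto simp: iota_act_xi[OF C _ a])
    then show ?thesis
      unfolding P.openin_pt[OF C] using alpha_in[OF C a] by blast
  qed
  moreover have "xi M C \<in> extensional (topspace (pt P C))"
    by (simp add: Dual_def P.topspace_pt[OF C])
  ultimately show ?thesis
    by (simp add: Top_simps(2) Q.continuous_map_pt[OF H_Obj[OF C]])
qed

lemma functor_incl: "is_functor (op_cat (TopC P)) (op_cat (TopC Q)) incl"
proof (rule is_functor_incl)
  show "Obj (op_cat (TopC P)) \<subseteq> Obj (op_cat (TopC Q))" using TopC_subset by auto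
qed (simp_all add: category_op_cat category_TopC, simp_all add: op_cat_def)

lemma nat_iso_zeta:
  "nat_iso (op_cat (TopC P)) (Cat Q) (fcomp H (Omega_functor P)) (fcomp (Omega_functor Q) incl) (zeta M)"
  unfolding nat_iso_def
proof (intro conjI ballI nat_transI)
  show "is_functor (op_cat (TopC P)) (Cat Q) (fcomp H (Omega_functor P))"
    by (rule is_functor_fcomp[OF P.is_functor_Omega functor_H])
  show "is_functor (op_cat (TopC P)) (Cat Q) (fcomp (Omega_functor Q) incl)"
    by (rule is_functor_fcomp[OF functor_incl Q.is_functor_Omega])
  show "iso_arr (Cat Q) (fobj (fcomp H (Omega_functor P)) X) (fobj (fcomp (Omega_functor Q) incl) X) (zeta M X)"
    if "X \<in> Obj (op_cat (TopC P))" for X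
    using zeta_iso that by simp
  show "zeta M X \<in> Hom (Cat Q) (fobj (fcomp H (Omega_functor P)) X) (fobj (fcomp (Omega_functor Q) incl) X)"
    if "X \<in> Obj (op_cat (TopC P))" for X
    using iso_arr_Hom[OF zeta_iso] that by simp
  show "Cmp (Cat Q) (fobj (fcomp H (Omega_functor P)) X) (fobj (fcomp H (Omega_functor P)) Y)
      (fobj (fcomp (Omega_functor Q) incl) Y) (zeta M Y) (farr (fcomp H (Omega_functor P)) X Y f) =
    Cmp (Cat Q) (fobj (fcomp H (Omega_functor P)) X) (fobj (fcomp (Omega_functor Q) incl) X)
      (fobj (fcomp (Omega_functor Q) incl) Y) (farr (fcomp (Omega_functor Q) incl) X Y f) (zeta M X)"
    if "X \<in> Obj (op_cat (TopC P))" "Y \<in> Obj (op_cat (TopC P))" "f \<in> Hom (op_cat (TopC P)) X Y" for X Y f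
  proof -
    have X: "X \<in> Obj (TopC P)" and Y: "Y \<in> Obj (TopC P)" and f: "f \<in> Hom Top Y X"
      using that by simp_all
    note TX = TopC_subset[OF X] and TY = TopC_subset[OF Y]
    note PX = P.Omega_Obj[OF X] and PY = P.Omega_Obj[OF Y]
    note QX = Q.Omega_Obj[OF TX] and QY = Q.Omega_Obj[OF TY]
    note HX = H_Obj[OF PX] and HY = H_Obj[OF PY]
    note Pf = P.Omega_arr[OF X Y f] and Qf = Q.Omega_arr[OF TX TY f]
    note Hf = H_Hom[OF PX PY Pf(1)]
    note zX = iso_arr_Hom[OF zeta_iso[OF X]] and zY = iso_arr_Hom[OF zeta_iso[OF Y]]
    have "Cmp (Cat Q) (fobj H (Omega P X)) (fobj H (Omega P Y)) (Omega Q Y) (zeta M Y)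
        (farr H (Omega P X) (Omega P Y) (farr (Omega_functor P) X Y f)) =
      Cmp (Cat Q) (fobj H (Omega P X)) (Omega Q X) (Omega Q Y) (farr (Omega_functor Q) X Y f) (zeta M X)"
      (is "?l = ?r")
    proof (rule Q.Omega_arr_eqI[OF TY HX Q.Cmp_Hom[OF HX HY QY Hf zY] Q.Cmp_Hom[OF HX QX QY zX Qf(1)]])
      fix a assume a: "a \<in> und Q (fobj H (Omega P X))"
      show "theta Q Y (act Q (fobj H (Omega P X)) (Omega Q Y) ?l a) =
          theta Q Y (act Q (fobj H (Omega P X)) (Omega Q Y) ?r a)"
        unfolding Q.act_Cmp[OF HX HY QY Hf zY a] Q.act_Cmp[OF HX QX QY zX Qf(1) a]
          theta_zeta[OF Y Q.act_in[OF HX HY Hf a]] alpha_nat[OF PX PY Pf(1) a] Pf(2)[OF alpha_in[OF PX a]]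
          Qf(2)[OF Q.act_in[OF HX QX zX a]] theta_zeta[OF X a] ..
    qed
    then show ?thesis by simp
  qed
qed

lemma nat_trans_xi:
  "nat_trans (Cat P) (op_cat (TopC Q)) (fcomp (pt_functor Q) H) (fcomp incl (pt_functor P)) (xi M)"
proof (rule nat_transI)
  show "is_functor (Cat P) (op_cat (TopC Q)) (fcomp (pt_functor Q) H)"
    by (rule is_functor_fcomp[OF functor_H Q.is_functor_pt])
  show "is_functor (Cat P) (op_cat (TopC Q)) (fcomp incl (pt_functor P))"
    by (rule is_functor_fcomp[OF P.is_functor_pt functor_incl])
  show "xi M C \<in> Hom (op_cat (TopC Q)) (fobj (fcomp (pt_functor Q) H) C) (fobj (fcomp incl (pt_functor P)) C)"
    if "C \<in> Obj (Cat P)" for C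
    using xi_Hom[OF that] by simp
  show "Cmp (op_cat (TopC Q)) (fobj (fcomp (pt_functor Q) H) C) (fobj (fcomp (pt_functor Q) H) D)
      (fobj (fcomp incl (pt_functor P)) D) (xi M D) (farr (fcomp (pt_functor Q) H) C D p) =
    Cmp (op_cat (TopC Q)) (fobj (fcomp (pt_functor Q) H) C) (fobj (fcomp incl (pt_functor P)) C)
      (fobj (fcomp incl (pt_functor P)) D) (farr (fcomp incl (pt_functor P)) C D p) (xi M C)"
    if C: "C \<in> Obj (Cat P)" and D: "D \<in> Obj (Cat P)" and p: "p \<in> Hom (Cat P) C D" for C D p
  proof -
    have "farr (pt_functor Q) (fobj H C) (fobj H D) (farr H C D p) (xi M D f) =
        xi M C (farr (pt_functor P) C D p f)" if "f \<in> topspace (pt P D)" for f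
    proof -
      have f: "f \<in> Hom (Cat P) D (two P)" using that P.topspace_pt[OF D] by simp
      have "Cmp (Cat Q) (fobj H C) (fobj H D) (two Q)
          (Cmp (Cat Q) (fobj H D) (fobj H (two P)) (two Q) i (farr H D (two P) f)) (farr H C D p) =
        Cmp (Cat Q) (fobj H C) (fobj H (two P)) (two Q) i
          (Cmp (Cat Q) (fobj H C) (fobj H D) (fobj H (two P)) (farr H D (two P) f) (farr H C D p))"
        using Q.category_Cat H_Obj[OF C] H_Obj[OF D] H_two Q.two_Obj H_Hom[OF C D p] H_Hom[OF D P.two_Obj f] i_Hom
        unfolding category_def by blast
      then show ?thesis
        unfolding Q.farr_pt_functor[OF xi_in[OF D f]] P.farr_pt_functor[OF f]
        unfolding xi_apply[OF f]
          xi_apply[OF P.Cmp_Hom[OF C D P.two_Obj p f]] H_Cmp[OF C D P.two_Obj p f] .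
    qed
    then show ?thesis by (auto simp: compose_def fun_eq_iff)
  qed
qed

text \<open>Here \<open>\<xi>\<close> is recognised as the mate of \<open>\<zeta>\<close>, by comparing the values of both sides on \<open>O(HC)\<close>.\<close>

lemma xi_mate:
  assumes C: "C \<in> Obj (Cat P)" and f: "f \<in> topspace (pt P C)"
  shows "xi M C f =
    farr (pt_functor Q) (fobj H C) (fobj H (Omega P (pt P C))) (farr H C (Omega P (pt P C)) (eta P C))
     (farr (pt_functor Q) (fobj H (Omega P (pt P C))) (Omega Q (pt P C)) (zeta M (pt P C))
       (sigma Q (pt P C) f))"
proof -
  note T = P.pt_TopC[OF C]
  note TQ = TopC_subset[OF T] and O = P.Omega_Obj[OF T] and e = P.eta[OF C T]
  note OQ = Q.Omega_Obj[OF TQ] and HO = H_Obj[OF O] and HC = H_Obj[OF C] and He = H_Hom[OF C O e(1)]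
  note z = iso_arr_Hom[OF zeta_iso[OF T]] and s = Q.sigma_in[OF TQ f]
  note sz = Q.Cmp_Hom[OF HO OQ Q.two_Obj z s]
  have f': "f \<in> Hom (Cat P) C (two P)" using f P.topspace_pt[OF C] by simp
  show ?thesis
    unfolding Q.farr_pt_functor[OF s] Q.farr_pt_functor[OF sz]
  proof (rule Q.arr_eqI[OF HC Q.two_Obj xi_in[OF C f'] Q.Cmp_Hom[OF HC HO Q.two_Obj He sz]])
    fix a assume a: "a \<in> und Q (fobj H C)"
    note Hea = Q.act_in[OF HC HO He a]
    have "act Q (fobj H C) (two Q) (xi M C f) a = iota_inv Q (iota P (act P C (two P) f (\<alpha> C a)))"
      using Q.iota_inv_iota[OF Q.act_in[OF HC Q.two_Obj xi_in[OF C f'] a]] iota_act_xi[OF C f' a] by simp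
    then show "act Q (fobj H C) (two Q) (xi M C f) a = act Q (fobj H C) (two Q)
       (Cmp (Cat Q) (fobj H C) (fobj H (Omega P (pt P C))) (two Q)
         (Cmp (Cat Q) (fobj H (Omega P (pt P C))) (Omega Q (pt P C)) (two Q) (sigma Q (pt P C) f) (zeta M (pt P C)))
         (farr H C (Omega P (pt P C)) (eta P C))) a"
      unfolding Q.act_Cmp[OF HC HO Q.two_Obj He sz a] Q.act_Cmp[OF HO OQ Q.two_Obj z s Hea]
        Q.act_sigma[OF TQ f Q.act_in[OF HO OQ z Hea]] theta_zeta[OF T Hea] alpha_nat[OF C O e(1) a]
        e(2)[OF alpha_in[OF C a]] P.evaluation_apply[OF f'] .
  qed
qed

theorem right_adj_morphism_Dual:
  "right_adj_morphism (Cat P) (op_cat (TopC P)) (dual_adj P) (Cat Q) (op_cat (TopC Q)) (dual_adj Q) M"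
proof -
  have M: "lfun M = H" "rfun M = incl" by (simp_all add: Dual_def)
  have J: "ladj (dual_adj R) = pt_functor R" "radj (dual_adj R) = Omega_functor R"
    "unit (dual_adj R) = eta R" "counit (dual_adj R) = sigma R" for R :: "('r, 'u) pfc"
    by (simp_all add: dual_adj_def)
  have mate: "xi M C = compose (topspace (pt P C))
      (compose (topspace (pt Q (Omega Q (pt P C))))
        (farr (pt_functor Q) (fobj H C) (fobj H (Omega P (pt P C))) (farr H C (Omega P (pt P C)) (eta P C)))
        (farr (pt_functor Q) (fobj H (Omega P (pt P C))) (Omega Q (pt P C)) (zeta M (pt P C))))
      (sigma Q (pt P C))" if C: "C \<in> Obj (Cat P)" for C
  proof (rule extensionalityI[where A = "topspace (pt P C)"])
    show "xi M C \<in> extensional (topspace (pt P C))" using xi_Hom[OF C] by (simp add: Top_simps(2))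
  next
    fix f assume f: "f \<in> topspace (pt P C)"
    have "sigma Q (pt P C) f \<in> topspace (pt Q (Omega Q (pt P C)))"
      using Top_arr_in[OF Q.sigma_Hom[OF TopC_subset[OF P.pt_TopC[OF C]]] f] .
    then show "xi M C f = compose (topspace (pt P C))
      (compose (topspace (pt Q (Omega Q (pt P C))))
        (farr (pt_functor Q) (fobj H C) (fobj H (Omega P (pt P C))) (farr H C (Omega P (pt P C)) (eta P C)))
        (farr (pt_functor Q) (fobj H (Omega P (pt P C))) (Omega Q (pt P C)) (zeta M (pt P C))))
      (sigma Q (pt P C)) f"
      using f xi_mate[OF C f] by (simp add: compose_eq)
  qed simp
  show ?thesis
    unfolding right_adj_morphism_def M J Let_def
    by (intro conjI ballI P.adjunction_dual Q.adjunction_dual functor_H functor_incl nat_iso_zeta nat_trans_xi)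
      (simp add: mate)
qed

end

section \<open>Fiber-terminal objects\<close>

lemma pfcT_simps [simp]:
  "Cat (pfcT P) = full_sub (Cat P) {C. fiber_terminal P C}" "Ofun (pfcT P) = Ofun P"
  "two (pfcT P) = two P" "iota (pfcT P) = iota P"
  by (simp_all add: pfcT_def)

lemma lifts_pfcT [simp]: "lifts (pfcT P) A B h = lifts P A B h"
  by (simp add: lifts_def is_lift_def)

lemma iota_inv_pfcT [simp]: "iota_inv (pfcT P) = iota_inv P"
  by (simp add: iota_inv_def)

lemma pt_pfcT [simp]: "pt (pfcT P) C = pt P C"
  by (simp add: pt_def)

lemma pfc_category_pfcT:
  assumes "pfc_category P" "fiber_terminal P (two P)"
  shows "pfc_category (pfcT P)"
  using assms is_functor_full_sub unfolding pfc_category_def faithful_def by auto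

lemma Omega_lift_pfcT:
  assumes "Omega_lift P X E \<theta>" "fiber_terminal P E"
  shows "Omega_lift (pfcT P) X E \<theta>"
  using assms unfolding Omega_lift_def cartesian_lift_def by simp

text \<open>
  A bijective arrow with fiber-terminal domain has a retraction on underlying sets, given by an
  arrow of the category: its codomain, with the inverse frame isomorphism, is a point of the fiber.
\<close>

lemma (in pfc) fiber_terminal_retraction:
  assumes E: "fiber_terminal P E" and F: "F \<in> Obj (Cat P)" and p: "p \<in> Hom (Cat P) E F"
    and bij: "bij_betw (act P E F p) (und P E) (und P F)"
  obtains q where "q \<in> Hom (Cat P) F E" "\<And>a. a \<in> und P E \<Longrightarrow> act P F E q (act P E F p a) = a"
proof -
  have EO: "E \<in> Obj (Cat P)" using E by (simp add: fiber_terminal_def)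
  let ?LE = "fobj (Ofun P) E" and ?LF = "fobj (Ofun P) F"
  have "iso_arr Frm ?LE ?LF (act P E F p)"
    using Frm_iso_arr_iff_bij[OF act_Frm[OF EO F p]] bij by simp
  then obtain g where g: "iso_arr Frm ?LF ?LE g"
    "compose (und P E) g (act P E F p) = restrict (\<lambda>a. a) (und P E)"
    unfolding iso_arr_def by (auto simp del: Frm_simps(1))
  have "(F, g) \<in> fiber P ?LE" using F g(1) by (simp add: fiber_def)
  then have "fiber_le P ?LE (F, g) (E, Idt Frm ?LE)"
    using E by (simp add: fiber_terminal_def Let_def)
  then obtain q where q: "q \<in> Hom (Cat P) F E"
    "compose (und P F) (restrict (\<lambda>a. a) (und P E)) (act P F E q) = g"
    by (auto simp: fiber_le_def)
  have "act P F E q (act P E F p a) = a" if a: "a \<in> und P E" for a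
  proof -
    note pa = act_in[OF EO F p a]
    have "act P F E q (act P E F p a) = g (act P E F p a)"
      using pa act_in[OF F EO q(1) pa] by (simp add: q(2)[symmetric] compose_def)
    also have "\<dots> = a" using fun_cong[OF g(2), of a] a by (simp add: compose_def)
    finally show ?thesis .
  qed
  then show ?thesis using that q(1) by blast
qed

text \<open>
  A cartesian lift computed among the fiber-terminal objects is a cartesian lift in the whole
  category, provided the latter has one at all: the comparison arrow to that one is bijective.
\<close>

lemma (in pfc) Omega_lift_of_pfcT:
  assumes two: "fiber_terminal P (two P)" and E: "Omega_lift (pfcT P) X E \<theta>" and X: "X \<in> Obj (TopC P)"
  shows "Omega_lift P X E \<theta>"
proof -
  interpret T: pfc "pfcT P" using pfc_category_pfcT[OF pfc two] by unfold_locales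
  let ?F = "Omega P X"
  note F = Omega_lift_in_TopC[OF X] and FO = Omega_Obj[OF X]
  have ET: "fiber_terminal P E" and EO: "E \<in> Obj (Cat P)"
    using T.Omega_liftD(1)[OF E] by simp_all
  have bij: "bij_betw \<theta> (und P E) (Hom Top X Sierpinski)" using T.Omega_liftD(2)[OF E] by simp
  have \<theta>_in: "\<theta> a \<in> Hom Top X Sierpinski" if "a \<in> und P E" for a
    using bij_betwE[OF bij] that by blast
  have lx: "lifts P E (two P) (\<lambda>a. iota_inv P (\<theta> a x))" if "x \<in> topspace X" for x
    using T.Omega_liftD(3)[OF E that] by (simp add: comp_def chi_def)
  define p where "p = lift_of P E ?F (\<lambda>a. theta_inv P X (\<theta> a))"
  have p: "p \<in> Hom (Cat P) E ?F" and \<theta>p: "\<And>a. a \<in> und P E \<Longrightarrow> theta P X (act P E ?F p a) = \<theta> a"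
    unfolding p_def using Omega_arr_lift[OF X EO \<theta>_in lx] by simp_all
  have "bij_betw (theta P X \<circ> act P E ?F p) (und P E) (Hom Top X Sierpinski)"
    using bij by (rule bij_betw_cong[THEN iffD1, rotated]) (simp add: \<theta>p)
  then have bijp: "bij_betw (act P E ?F p) (und P E) (und P ?F)"
    by (subst bij_betw_comp_iff2[OF theta_bij[OF X]]) (rule image_subsetI[OF act_in[OF EO FO p]])
  obtain q where q: "q \<in> Hom (Cat P) ?F E" "\<And>a. a \<in> und P E \<Longrightarrow> act P ?F E q (act P E ?F p a) = a"
    using fiber_terminal_retraction[OF ET FO p bijp] by blast
  have "lifts P D E h \<longleftrightarrow> (\<forall>x\<in>topspace X. lifts P D (two P) (iota_inv P \<circ> chi x \<circ> \<theta> \<circ> h))"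
    if D: "D \<in> Obj (Cat P)" and h: "h \<in> und P D \<rightarrow> und P E" for D h
  proof
    assume l: "lifts P D E h"
    show "\<forall>x\<in>topspace X. lifts P D (two P) (iota_inv P \<circ> chi x \<circ> \<theta> \<circ> h)"
    proof
      fix x assume "x \<in> topspace X"
      then show "lifts P D (two P) (iota_inv P \<circ> chi x \<circ> \<theta> \<circ> h)"
        using lifts_Cmp[OF D EO two_Obj l lx h] by (simp add: comp_def chi_def)
    qed
  next
    assume r: "\<forall>x\<in>topspace X. lifts P D (two P) (iota_inv P \<circ> chi x \<circ> \<theta> \<circ> h)"
    have hin: "h a \<in> und P E" if "a \<in> und P D" for a using h that by blast
    have 1: "\<theta> (h a) \<in> Hom Top X Sierpinski" if "a \<in> und P D" for a
      using \<theta>_in[OF hin[OF that]] .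
    have 2: "lifts P D (two P) (\<lambda>a. iota_inv P (\<theta> (h a) x))" if "x \<in> topspace X" for x
      using r that by (simp add: comp_def chi_def)
    \<comment> \<open>Lift \<open>h\<close> to \<open>\<Omega>X\<close> instead of \<open>E\<close>, and correct by \<open>q\<close>.\<close>
    define k where "k = lift_of P D ?F (\<lambda>a. theta_inv P X (\<theta> (h a)))"
    have k: "k \<in> Hom (Cat P) D ?F" and \<theta>k: "\<And>a. a \<in> und P D \<Longrightarrow> theta P X (act P D ?F k a) = \<theta> (h a)"
      unfolding k_def using Omega_arr_lift[OF X D 1 2] by simp_all
    have kp: "act P D ?F k a = act P E ?F p (h a)" if a: "a \<in> und P D" for a
    proof (rule inj_onD[OF bij_betw_imp_inj_on[OF theta_bij[OF X]]])
      show "theta P X (act P D ?F k a) = theta P X (act P E ?F p (h a))"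
        unfolding \<theta>k[OF a] \<theta>p[OF hin[OF a]] ..
    qed (rule act_in[OF D FO k a], rule act_in[OF EO FO p hin[OF a]])
    show "lifts P D E h"
    proof (rule lifts_act[OF Cmp_Hom[OF D FO EO k q(1)]])
      fix a assume a: "a \<in> und P D"
      show "act P D E (Cmp (Cat P) D ?F E q k) a = h a"
        unfolding act_Cmp[OF D FO EO k q(1) a] kp[OF a] by (rule q(2)[OF hin[OF a]])
    qed
  qed
  then show ?thesis
    unfolding Omega_lift_def cartesian_lift_def using EO bij by blast
qed

lemma sfc_category_pfcT:
  assumes "total_sfc_category P"
  shows "sfc_category (pfcT P)"
proof -
  have P: "sfc_category P" and two: "fiber_terminal P (two P)"
    and S: "fiber_terminal P (Omega P Sierpinski)"
    and pt: "\<forall>C\<in>Obj (Cat (pfcT P)). pt P C \<in> Obj (TopC (pfcT P))"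
    using assms by (simp_all add: total_sfc_category_def)
  have "Sierpinski \<in> Obj (TopC P)" using P by (simp add: sfc_category_def)
  then have "Sierpinski \<in> Obj (TopC (pfcT P))"
    by (intro TopC_I[OF TopC_Top Omega_lift_pfcT[OF Omega_lift_in_TopC S]])
  then show ?thesis
    using P two pt unfolding sfc_category_def by (simp add: pfc_category_pfcT)
qed

lemma sfc_functor_pfcT:
  assumes P: "sfc_category P" and two: "fiber_terminal P (two P)" and sub: "Obj (TopC (pfcT P)) \<subseteq> Obj (TopC P)"
  shows "sfc_functor (pfcT P) P incl (\<lambda>C. Idt Frm (fobj (Ofun (pfcT P)) C)) (Idt (Cat P) (two P))"
proof -
  interpret pfc P using P by unfold_locales (simp add: sfc_category_def)
  interpret T: pfc "pfcT P" using pfc_category_pfcT[OF pfc two] by unfold_locales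
  have "is_functor (Cat (pfcT P)) (Cat P) incl"
    by (rule is_functor_incl[OF T.category_Cat category_Cat]) (auto simp: full_sub_def)
  moreover have "nat_iso (Cat (pfcT P)) Frm (fcomp (Ofun P) incl) (Ofun (pfcT P))
      (\<lambda>C. Idt Frm (fobj (Ofun (pfcT P)) C))"
    unfolding nat_iso_def
  proof (intro conjI nat_transI ballI)
    fix C assume "C \<in> Obj (Cat (pfcT P))"
    then have "fobj (Ofun P) C \<in> Obj Frm"
      using is_functorD(1)[OF functor_Ofun] by simp
    from iso_arr_Idt[OF category_Frm this]
    show i: "iso_arr Frm (fobj (fcomp (Ofun P) incl) C) (fobj (Ofun (pfcT P)) C) (Idt Frm (fobj (Ofun (pfcT P)) C))"
      by simp
    show "Idt Frm (fobj (Ofun (pfcT P)) C) \<in> Hom Frm (fobj (fcomp (Ofun P) incl) C) (fobj (Ofun (pfcT P)) C)"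
      using iso_arr_Hom[OF i] .
  next
    fix C D p assume C: "C \<in> Obj (Cat (pfcT P))" and D: "D \<in> Obj (Cat (pfcT P))" and p: "p \<in> Hom (Cat (pfcT P)) C D"
    have "act P C D p \<in> Hom Frm (fobj (Ofun P) C) (fobj (Ofun P) D)"
      using act_Frm C D p by simp
    moreover have "fobj (Ofun P) C \<in> Obj Frm" "fobj (Ofun P) D \<in> Obj Frm"
      using C D is_functorD(1)[OF functor_Ofun] by simp_all
    ultimately have "Cmp Frm (fobj (Ofun P) C) (fobj (Ofun P) D) (fobj (Ofun P) D) (Idt Frm (fobj (Ofun P) D)) (act P C D p) =
       Cmp Frm (fobj (Ofun P) C) (fobj (Ofun P) C) (fobj (Ofun P) D) (act P C D p) (Idt Frm (fobj (Ofun P) C))"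
      using category_Frm unfolding category_def by auto
    then show "Cmp Frm (fobj (fcomp (Ofun P) incl) C) (fobj (fcomp (Ofun P) incl) D) (fobj (Ofun (pfcT P)) D)
         (Idt Frm (fobj (Ofun (pfcT P)) D)) (farr (fcomp (Ofun P) incl) C D p) =
       Cmp Frm (fobj (fcomp (Ofun P) incl) C) (fobj (Ofun (pfcT P)) C) (fobj (Ofun (pfcT P)) D)
         (farr (Ofun (pfcT P)) C D p) (Idt Frm (fobj (Ofun (pfcT P)) C))"
      by simp
  qed (use T.functor_Ofun in simp_all)
  moreover have "iso_arr (Cat P) (two P) (two P) (Idt (Cat P) (two P))"
    by (rule iso_arr_Idt[OF category_Cat two_Obj])
  moreover have "compose (und P (two P)) (iota P) (act P (two P) (two P) (Idt (Cat P) (two P))) =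
      compose (und P (two P)) (iota P) (restrict (\<lambda>a. a) (und P (two P)))"
    using act_Idt[OF two_Obj] by (auto simp: compose_def)
  moreover have "cartesian_lift P (Hom Top X Sierpinski) (two P) (topspace X)
      (\<lambda>x. inv_into (und P (two P)) (restrict (\<lambda>a. a) (und P (two P))) \<circ> iota_inv P \<circ> chi x)
      (Omega (pfcT P) X) (theta (pfcT P) X \<circ> restrict (\<lambda>a. a) (und P (Omega (pfcT P) X)))"
    if X: "X \<in> Obj (TopC (pfcT P))" for X
  proof -
    have "Omega_lift P X (Omega (pfcT P) X) (theta (pfcT P) X)"
      using Omega_lift_of_pfcT[OF two Omega_lift_in_TopC[OF X]] sub X by blast
    moreover have "inv_into (und P (two P)) (restrict (\<lambda>a. a) (und P (two P))) s = s"
      if "s \<in> und P (two P)" for s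
      using inv_into_f_f[of "restrict (\<lambda>a. a) (und P (two P))" "und P (two P)" s] that by (simp add: inj_on_def)
    ultimately show ?thesis
      unfolding Omega_lift_def
      by (subst cartesian_lift_cong[where g = "\<lambda>x. iota_inv P \<circ> chi x" and \<theta>' = "theta (pfcT P) X"])
        (auto simp: Top_simps(2) chi_def continuous_map_Sierpinski iota_inv_in Pi_iff)
  qed
  ultimately show ?thesis
    unfolding sfc_functor_def by simp
qed

theorem theorem3p15:
  fixes P :: "('o, 'u::universe) pfc"
  assumes "total_sfc_category P"
  shows "sfc_category (pfcT P) \<and>
    sfc_functor (pfcT P) P incl (\<lambda>C. Idt Frm (fobj (Ofun (pfcT P)) C)) (Idt (Cat P) (two P)) \<and>
    strong_right_adj_morphism
      (Cat (pfcT P)) (op_cat (TopC (pfcT P))) (dual_adj (pfcT P))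
      (Cat P) (op_cat Top) (dual_adj P)
      (Dual (pfcT P) P incl (\<lambda>C. Idt Frm (fobj (Ofun (pfcT P)) C)) (Idt (Cat P) (two P)))"
proof -
  let ?\<alpha> = "\<lambda>C. Idt Frm (fobj (Ofun (pfcT P)) C)" and ?i = "Idt (Cat P) (two P)"
  have P: "sfc_category P" and Top: "TopC P = Top" and two: "fiber_terminal P (two P)"
    using assms by (simp_all add: total_sfc_category_def)
  have 1: "sfc_category (pfcT P)" using sfc_category_pfcT[OF assms] .
  have 2: "sfc_functor (pfcT P) P incl ?\<alpha> ?i"
    by (rule sfc_functor_pfcT[OF P two]) (auto simp del: Top_simps(1) simp: Top intro: TopC_Top)
  interpret sfc_functor_between "pfcT P" P incl ?\<alpha> ?i
    using 1 2 P by unfold_locales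
  have 3: "right_adj_morphism (Cat (pfcT P)) (op_cat (TopC (pfcT P))) (dual_adj (pfcT P))
      (Cat P) (op_cat Top) (dual_adj P) M"
    using right_adj_morphism_Dual by (simp only: Top)
  have "iso_arr Top (pt P C) (pt P C) (xi M C)" if C: "C \<in> Obj (Cat (pfcT P))" for C
  proof -
    have CP: "C \<in> Obj (Cat P)" using C by simp
    have "xi M C f = f" if f: "f \<in> Hom (Cat P) C (two P)" for f
      using f CP Q.category_Cat Q.two_Obj by (simp add: Dual_def category_def)
    then have "xi M C = Idt Top (pt P C)"
      using xi_Hom[OF C] by (auto simp: Top_simps(2) Q.topspace_pt[OF CP] extensional_def fun_eq_iff)
    then show ?thesis
      using iso_arr_Idt[OF category_Top TopC_Top[OF Q.pt_TopC[OF CP]]] by simp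
  qed
  then have "nat_iso (Cat (pfcT P)) (op_cat Top) (fcomp (ladj (dual_adj P)) (lfun M))
      (fcomp (rfun M) (ladj (dual_adj (pfcT P)))) (xi M)"
    using nat_trans_xi unfolding nat_iso_def Top
    by (simp add: Dual_def dual_adj_def)
  then show ?thesis
    using 1 2 3 unfolding strong_right_adj_morphism_def by blast
qed

end
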